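(* Let $w\in L^1(\mathbb{R}^d)\cap L^\infty(\mathbb{R}^d)$, $w\neq0$, satisfy: for any $a>0$ there exists $c_a>0$ such that $w(\xi)\le c_ae^{-a|\xi|}$ for almost all $\xi\in\mathbb{R}^d$. Assume there exist measurable functions $Q_1,\dots,Q_d:[0,\infty)\to\mathbb{R}$ such that $$w(\xi_1,\dots,\xi_d)=\prod_{i=1}^de^{-Q_i(|\xi_i|)},$$ that $|Q_i-Q_j|$ is bounded for all $i,j\in\{1,\dots,d\}$, and that for each $i=1,\dots,d$ and any $L>0$ there exists $B_i>0$ such that for any sufficiently large $t>0$, $$\int_0^{\pi/2}(Q_i)_L^{\rm o}(t\cos\theta)\,d\theta<B_i+\log t.$$ Then: (B) there exists $B>0$ such that for any $y\in\mathbb{R}^d$, $\limsup_{n\to\infty}\mathcal{E}_n^-(y;w)<B$ and $\limsup_{n\to\infty}\mathcal{E}_n^+(y;w)<B$; (C) $\mathcal{G}(w)$ spans ${\rm M}_d(\mathbb{R})$ as a real vector space.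
   Context: For $L\in\mathbb{R}$ and measurable $Q:[0,\infty)\to\mathbb{R}$, put $Q_L(t):=Q(t)-Lt$. For measurable $Q$ define $Q^{\rm m}(t):=\inf\{T\in\mathbb{R}:|\{s\ge t:T\ge Q(s)\}|>0\}$, where $|\cdot|$ of a set is Lebesgue measure, and $Q^{\rm o}:=Q-Q^{\rm m}$. Write $Q_L^{\rm o}:=(Q_L)^{\rm o}$. $L^2(w)$ is the $L^2$-space for the measure $w(\xi)\,d\xi$. $P_n\subset\mathbb{C}[\xi_1,\dots,\xi_d]$ is the space of polynomials of total degree at most $n$, regarded as a subspace of $L^2(w)$. For $y\in\mathbb{R}^d$, $(m_yh)(\xi)=e^{y^\top\xi}h(\xi)$. Define $$\mathcal{E}_n^+(y;w)=\Big(\sup_{P\in P_n\setminus\{0\}}\frac{\|m_yP\|_{L^2(w)}}{\|P\|_{L^2(w)}}\Big)^{1/n},\qquad \mathcal{E}_n^-(y;w)=\Big(\sup_{P\in P_n\setminus\{0\}}\frac{\|P\|_{L^2(w)}}{\|m_yP\|_{L^2(w)}}\Big)^{1/n}.$$ $\mathcal{G}(w)$ is the set of $A\in{\rm GL}_d(\mathbb{R})$ such that for some $\lambda>0$, $w(A^\top\xi)\ge\lambda w(\xi)$ for almost every $\xi\in\mathbb{R}^d$. *)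

theory Defs
  imports "HOL-Analysis.Analysis"
begin

definition shift_lin :: "real \<Rightarrow> (real \<Rightarrow> real) \<Rightarrow> real \<Rightarrow> real" where
  "shift_lin L Q = (\<lambda>t. Q t - L * t)"

text \<open>Functions on \<open>[0,\<infinity>)\<close> are total functions on the reals of which only the values at
  nonnegative arguments are used. The infimum is taken in the extended reals, so it is
  \<open>-\<infinity>\<close> when the set of admissible \<open>T\<close> is unbounded below.\<close>

definition ess_inf_tail :: "(real \<Rightarrow> real) \<Rightarrow> real \<Rightarrow> ereal" where
  "ess_inf_tail Q t = (INF T \<in> {T. emeasure lebesgue {s. s \<ge> t \<and> T \<ge> Q s} > 0}. ereal T)"

text \<open>For measurable \<open>Q\<close> this is nonnegative at almost every \<open>t \<ge> 0\<close>, so nothing is lost when it is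
  integrated as a function with values in \<^typ>\<open>ennreal\<close>. A Bochner integral would
  not do: it is \<open>0\<close> for non-integrable functions.\<close>

definition oscillation_part :: "(real \<Rightarrow> real) \<Rightarrow> real \<Rightarrow> ereal" where
  "oscillation_part Q t = ereal (Q t) - ess_inf_tail Q t"

definition enn_root :: "nat \<Rightarrow> ennreal \<Rightarrow> ennreal" where
  "enn_root n x = (if x = top then top else ennreal (root n (enn2real x)))"

text \<open>Only used for weights that are nonnegative almost everywhere; \<^const>\<open>ennreal\<close>
  sends negative reals to \<open>0\<close>.\<close>

definition L2_norm_weight :: "(real^'d \<Rightarrow> real) \<Rightarrow> (real^'d \<Rightarrow> complex) \<Rightarrow> ennreal" where
  "L2_norm_weight w f = enn_root 2 (\<integral>\<^sup>+\<xi>. ennreal ((cmod (f \<xi>))\<^sup>2) * ennreal (w \<xi>) \<partial>lebesgue)"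

text \<open>Polynomials in \<open>d\<close> variables with complex coefficients and total degree at most \<open>n\<close>,
  identified with the functions they induce on real \<open>d\<close>-space; this identification is
  injective because the reals are infinite. The index set of the sum is finite, see below.\<close>

definition poly_funs :: "nat \<Rightarrow> (real^'d \<Rightarrow> complex) set" where
  "poly_funs n = {P. \<exists>c :: ('d \<Rightarrow> nat) \<Rightarrow> complex.
     P = (\<lambda>\<xi>. \<Sum>\<alpha> | (\<Sum>i\<in>UNIV. \<alpha> i) \<le> n. c \<alpha> * (\<Prod>i\<in>UNIV. complex_of_real (\<xi> $ i) ^ \<alpha> i))}"

lemma finite_multi_indices: "finite {\<alpha> :: 'd::finite \<Rightarrow> nat. (\<Sum>i\<in>UNIV. \<alpha> i) \<le> n}"
proof -
  have "\<alpha> i \<le> n" if "(\<Sum>i\<in>UNIV. \<alpha> i) \<le> n" for \<alpha> :: "'d \<Rightarrow> nat" and i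
    using member_le_sum[of i UNIV \<alpha>] that by simp
  then have "{\<alpha> :: 'd \<Rightarrow> nat. (\<Sum>i\<in>UNIV. \<alpha> i) \<le> n} \<subseteq> PiE UNIV (\<lambda>_. {..n})"
    by (simp add: PiE_UNIV_domain subset_iff)
  then show ?thesis
    by (rule finite_subset) (simp add: finite_PiE)
qed

definition exp_mult :: "real^'d \<Rightarrow> (real^'d \<Rightarrow> complex) \<Rightarrow> real^'d \<Rightarrow> complex" where
  "exp_mult y h = (\<lambda>\<xi>. complex_of_real (exp (y \<bullet> \<xi>)) * h \<xi>)"

text \<open>The values at \<open>n = 0\<close> follow the convention \<open>root 0 x = 0\<close>; only large \<open>n\<close> matter.\<close>

definition E_plus :: "nat \<Rightarrow> real^'d \<Rightarrow> (real^'d \<Rightarrow> real) \<Rightarrow> ennreal" where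
  "E_plus n y w = enn_root n
     (SUP P \<in> poly_funs n - {\<lambda>_. 0}. L2_norm_weight w (exp_mult y P) / L2_norm_weight w P)"

definition E_minus :: "nat \<Rightarrow> real^'d \<Rightarrow> (real^'d \<Rightarrow> real) \<Rightarrow> ennreal" where
  "E_minus n y w = enn_root n
     (SUP P \<in> poly_funs n - {\<lambda>_. 0}. L2_norm_weight w P / L2_norm_weight w (exp_mult y P))"

definition quasi_sym :: "(real^'d \<Rightarrow> real) \<Rightarrow> (real^'d^'d) set" where
  "quasi_sym w = {A. invertible A \<and>
     (\<exists>l>0. AE \<xi> in lebesgue. w (transpose A *v \<xi>) \<ge> l * w \<xi>)}"

end

theory Submission
  imports Defs "HOL-Computational_Algebra.Fundamental_Theorem_Algebra"
begin

text \<open>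
The statement (C) holds because the weight is, up to constant factors, invariant under sign changes and
permutations of the coordinates; signed permutation matrices span all matrices.

The statement (B) reduces to one variable. The integrands of \<open>\<parallel>P\<parallel>\<^sup>2\<close> and \<open>\<parallel>m\<^sub>y P\<parallel>\<^sup>2\<close> lie between
\<open>\<bar>P\<bar>\<^sup>2 w\<close> times the product of the factors \<open>exp (\<plusminus> 2 Y \<bar>\<xi>\<^sub>i\<bar>)\<close>, where \<open>Y = \<bar>y\<bar>\<close>, and since \<open>w\<close> is a product,
the signs can be changed one coordinate at a time by Fubini's theorem. It remains to bound, for polynomials
\<open>p\<close> of degree at most \<open>n\<close> in one variable and \<open>n\<close> large, the integral of
\<open>\<bar>p\<bar>\<^sup>2 exp (2 Y \<bar>x\<bar> - Q \<bar>x\<bar>)\<close> by \<open>C K\<^sup>n\<close> times that of \<open>\<bar>p\<bar>\<^sup>2 exp (- 2 Y \<bar>x\<bar> - Q \<bar>x\<bar>)\<close>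
(\<open>weighted_poly_comparison_1d\<close>). Here \<open>K\<close> must be absolute, whereas \<open>C\<close> may depend on everything
except \<open>n\<close> and \<open>p\<close>, because \<open>n\<close>-th roots are taken.

Put \<open>L = 4 Y + 2\<close> and \<open>R = n / L\<close>. On \<open>[-R,R]\<close> the factors \<open>exp (\<plusminus> 2 Y \<bar>x\<bar>)\<close> cost at most
\<open>exp n\<close> each. The integral over \<open>\<bar>x\<bar> > R\<close> is controlled by a restricted range inequality
(\<open>poly_outside_bound\<close>). Up to a factor \<open>(K \<bar>x\<bar> / R)\<^sup>n\<close>, the value \<open>\<bar>p x\<bar>\<close> outside the interval is at most
the geometric mean of \<open>\<bar>p\<bar>\<close> over \<open>[-R,R]\<close> with respect to the arcsine measure. This can be checked on
linear factors, where it only says that \<open>ln \<bar>R cos \<theta> - a\<bar>\<close> has mean at least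
\<open>ln (max R \<bar>a\<bar>)\<close> minus a constant. Multiplying by the weight and applying Jensen's inequality, one obtains
a bound by the integral of \<open>\<bar>p\<bar>\<^sup>2 exp (- Q)\<close> over \<open>[-R,R]\<close> times the exponential of the mean of
\<open>Q (R cos \<theta>)\<close>.

This is where the hypothesis on the oscillation enters. Let \<open>m\<close> be the essential infimum of \<open>Q s - L s\<close> over
\<open>s \<ge> R\<close>. The integral of \<open>Q (R cos \<theta>)\<close> minus \<open>L R + m\<close> is at most that of the oscillation, hence at most
\<open>B + ln R\<close>. On the other hand the weight at almost every \<open>\<bar>x\<bar> \<ge> R\<close> is at most \<open>exp (- L \<bar>x\<bar> - m)\<close>. The numbers
\<open>m\<close> cancel, \<open>L R = n\<close> is harmless, and the surplus decay \<open>exp (- L \<bar>x\<bar>)\<close> dominates both the growth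
\<open>(\<bar>x\<bar> / R)\<^sup>2\<^sup>n\<close> of the polynomial and the factor \<open>exp (2 Y \<bar>x\<bar>)\<close>.
\<close>

section \<open>Logarithmic means on a quarter period\<close>

text \<open>A rough form of Jordan's inequality, from the concavity of the sine; the constant only has to be
  absolute.\<close>

lemma half_le_sin:
  fixes x :: real
  assumes "0 \<le> x" "x \<le> pi/2"
  shows "x / 2 \<le> sin x"
proof -
  have c: "concave_on {0..pi/2} sin"
    unfolding concave_on_def
    by (rule f''_ge0_imp_convex[where f' = "\<lambda>x. - cos x" and f'' = "\<lambda>x. sin x"])
       (auto intro!: derivative_eq_intros sin_ge_zero)
  have "(1 - 2*x/pi) * sin 0 + (2*x/pi) * sin (pi/2) \<le> sin ((1 - 2*x/pi) *\<^sub>R 0 + (2*x/pi) *\<^sub>R (pi/2))"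
    using assms by (intro concave_onD[OF c]) (auto simp: field_simps)
  then have "2*x/pi \<le> sin x" by simp
  moreover have "x/2 \<le> 2*x/pi"
    using assms pi_less_4 mult_right_mono[of pi 4 x] by (auto simp: field_simps)
  ultimately show ?thesis by simp
qed

text \<open>Uniformly in \<open>b\<close>, the function \<open>cos\<^sup>2 \<theta> - b\<close> has at worst one quadratic zero on the quarter period,
  and it is of size \<open>\<bar>b\<bar>\<close> for large \<open>b\<close>. The point \<open>\<phi>\<close> is where \<open>cos\<^sup>2\<close> comes closest to \<open>Re b\<close>. There
  \<open>cos\<^sup>2 \<theta> - cos\<^sup>2 \<phi> = sin (\<phi> - \<theta>) * sin (\<phi> + \<theta>)\<close>, and \<open>\<bar>\<theta> - \<phi>\<bar> / 2\<close> is a lower bound for the absolute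
  value of each factor; for the second one because both \<open>\<phi> + \<theta>\<close> and \<open>pi - (\<phi> + \<theta>)\<close> are at least
  \<open>\<bar>\<theta> - \<phi>\<bar>\<close>.\<close>

lemma cos_sq_diff_lower_bound:
  fixes b :: complex
  obtains \<phi> where "0 \<le> \<phi>" "\<phi> \<le> pi/2"
    "\<And>\<theta>. 0 \<le> \<theta> \<Longrightarrow> \<theta> \<le> pi/2 \<Longrightarrow>
       max 1 (cmod b) * (\<theta> - \<phi>)\<^sup>2 / 8 \<le> cmod (complex_of_real ((cos \<theta>)\<^sup>2) - b)"
proof -
  define \<beta> where "\<beta> = min 1 (max 0 (Re b))"
  define \<phi> where "\<phi> = arccos (sqrt \<beta>)"
  have \<beta>: "0 \<le> \<beta>" "\<beta> \<le> 1" by (auto simp: \<beta>_def)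
  then have s: "0 \<le> sqrt \<beta>" "sqrt \<beta> \<le> 1" by auto
  have \<phi>: "0 \<le> \<phi>" "\<phi> \<le> pi/2" and c\<phi>: "cos \<phi> = sqrt \<beta>"
    using s arccos_lbound[of "sqrt \<beta>"] arccos_le_pi2[of "sqrt \<beta>"] cos_arccos[of "sqrt \<beta>"]
    unfolding \<phi>_def by linarith+
  have quad: "(\<theta> - \<phi>)\<^sup>2 / 4 \<le> \<bar>(cos \<theta>)\<^sup>2 - (cos \<phi>)\<^sup>2\<bar>" if \<theta>: "0 \<le> \<theta>" "\<theta> \<le> pi/2" for \<theta>
  proof -
    have eq: "(cos \<theta>)\<^sup>2 - (cos \<phi>)\<^sup>2 = sin (\<phi> - \<theta>) * sin (\<phi> + \<theta>)"
    proof -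
      have "sin (\<phi> - \<theta>) * sin (\<phi> + \<theta>) = (sin \<phi>)\<^sup>2 * (cos \<theta>)\<^sup>2 - (cos \<phi>)\<^sup>2 * (sin \<theta>)\<^sup>2"
        by (simp add: sin_add sin_diff algebra_simps power2_eq_square)
      also have "\<dots> = (cos \<theta>)\<^sup>2 - (cos \<phi>)\<^sup>2"
        by (simp add: sin_squared_eq algebra_simps)
      finally show ?thesis by simp
    qed
    have 1: "\<bar>\<theta> - \<phi>\<bar> / 2 \<le> \<bar>sin (\<phi> - \<theta>)\<bar>"
    proof (cases "\<theta> \<le> \<phi>")
      case True
      then show ?thesis using half_le_sin[of "\<phi> - \<theta>"] \<phi> \<theta> by (auto simp: abs_if)
    next
      case False
      have "sin (\<phi> - \<theta>) = - sin (\<theta> - \<phi>)" by (metis minus_diff_eq sin_minus)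
      then show ?thesis using False half_le_sin[of "\<theta> - \<phi>"] \<phi> \<theta> by (auto simp: abs_if)
    qed
    have 2: "\<bar>\<theta> - \<phi>\<bar> / 2 \<le> \<bar>sin (\<phi> + \<theta>)\<bar>"
    proof (cases "\<phi> + \<theta> \<le> pi/2")
      case True
      then show ?thesis using half_le_sin[of "\<phi> + \<theta>"] \<phi> \<theta> by (auto simp: abs_if split: if_splits)
    next
      case False
      have "\<bar>\<theta> - \<phi>\<bar> / 2 \<le> (pi - (\<phi> + \<theta>)) / 2"
        using \<phi> \<theta> by (intro divide_right_mono) auto
      also have "\<dots> \<le> sin (pi - (\<phi> + \<theta>))"
        using False \<phi> \<theta> by (intro half_le_sin) auto
      also have "\<dots> = sin (\<phi> + \<theta>)" by (rule sin_pi_minus)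
      also have "\<dots> \<le> \<bar>sin (\<phi> + \<theta>)\<bar>" by (rule abs_ge_self)
      finally show ?thesis .
    qed
    have "(\<bar>\<theta> - \<phi>\<bar>/2) * (\<bar>\<theta> - \<phi>\<bar>/2) \<le> \<bar>sin (\<phi> - \<theta>)\<bar> * \<bar>sin (\<phi> + \<theta>)\<bar>"
      using 1 2 by (intro mult_mono) auto
    then have "(\<theta> - \<phi>)\<^sup>2 / 4 \<le> \<bar>sin (\<phi> - \<theta>)\<bar> * \<bar>sin (\<phi> + \<theta>)\<bar>"
      by (simp add: power2_eq_square)
    then show ?thesis by (simp only: eq abs_mult)
  qed
  show thesis
  proof (rule that[OF \<phi>])
    fix \<theta> :: real assume \<theta>: "0 \<le> \<theta>" "\<theta> \<le> pi/2"
    have c1: "0 \<le> (cos \<theta>)\<^sup>2" "(cos \<theta>)\<^sup>2 \<le> 1" by (auto simp: abs_square_le_1)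
    show "max 1 (cmod b) * (\<theta> - \<phi>)\<^sup>2 / 8 \<le> cmod (complex_of_real ((cos \<theta>)\<^sup>2) - b)"
    proof (cases "cmod b < 2")
      case True
      have "max 1 (cmod b) * (\<theta> - \<phi>)\<^sup>2 \<le> 2 * (\<theta> - \<phi>)\<^sup>2"
        using True by (intro mult_right_mono) auto
      moreover have "\<bar>(cos \<theta>)\<^sup>2 - \<beta>\<bar> \<le> \<bar>(cos \<theta>)\<^sup>2 - Re b\<bar>"
        using c1 by (auto simp: \<beta>_def min_def max_def abs_if split: if_splits)
      moreover have "\<bar>(cos \<theta>)\<^sup>2 - Re b\<bar> \<le> cmod (complex_of_real ((cos \<theta>)\<^sup>2) - b)"
        using abs_Re_le_cmod[of "complex_of_real ((cos \<theta>)\<^sup>2) - b"] by (simp del: of_real_power)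
      ultimately show ?thesis using quad[OF \<theta>] \<beta> by (simp add: c\<phi> del: of_real_power)
    next
      case False
      have "\<bar>\<theta> - \<phi>\<bar> \<le> 2" using \<theta> \<phi> pi_less_4 by auto
      then have "(\<theta> - \<phi>)\<^sup>2 \<le> 2\<^sup>2" by (metis abs_le_square_iff abs_numeral)
      then have "cmod b * (\<theta> - \<phi>)\<^sup>2 \<le> cmod b * 4" by (intro mult_left_mono) auto
      moreover have "cmod b - cmod (complex_of_real ((cos \<theta>)\<^sup>2)) \<le> cmod (complex_of_real ((cos \<theta>)\<^sup>2) - b)"
        by (metis norm_minus_commute norm_triangle_ineq2)
      moreover have "cmod (complex_of_real ((cos \<theta>)\<^sup>2)) \<le> 1"
        using c1 by (simp del: of_real_power)
      ultimately show ?thesis using False by (simp del: of_real_power)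
    qed
  qed
qed

text \<open>The substitution \<open>s = R * cos \<theta>\<close> turns Lebesgue measure on the quarter period into the arcsine measure
  of \<open>[0,R]\<close>, up to normalization. Polynomials are treated on \<open>[-R,R]\<close> through the even product
  \<open>p s * p (- s)\<close>, so a quarter period is enough.\<close>

abbreviation quarter :: "real measure" where
  "quarter \<equiv> restrict_space lborel {0..pi/2}"

lemma nn_integral_quarter: "(\<integral>\<^sup>+\<theta>. f \<theta> \<partial>quarter) = (\<integral>\<^sup>+\<theta>\<in>{0..pi/2}. f \<theta> \<partial>lborel)"
  by (subst nn_integral_restrict_space) auto

lemma AE_quarter: "(AE \<theta> in quarter. P \<theta>) \<longleftrightarrow> (AE \<theta> in lborel. 0 \<le> \<theta> \<and> \<theta> \<le> pi/2 \<longrightarrow> P \<theta>)"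
  by (subst AE_restrict_space_iff) auto

lemma finite_measure_quarter: "finite_measure quarter"
  by (rule finite_measureI) (simp add: emeasure_restrict_space space_restrict_space)

lemma measure_quarter: "measure quarter {0..pi/2} = pi/2"
  by (simp add: measure_restrict_space space_restrict_space)

text \<open>The derivative of \<open>\<theta> \<mapsto> sqrt (\<theta> - \<phi>)\<close> away from \<open>\<phi>\<close>, with the odd extension of the square root to
  negative arguments. It dominates the logarithmic singularity of \<open>ln \<bar>\<theta> - \<phi>\<bar>\<close> and has a continuous
  elementary primitive, which makes a bound uniform in \<open>\<phi>\<close> immediate.\<close>

definition sqrt_pole :: "real \<Rightarrow> real \<Rightarrow> real" where
  "sqrt_pole \<phi> \<theta> = 1 / (2 * sqrt \<bar>\<theta> - \<phi>\<bar>)"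

lemma sqrt_pole_integrable:
  assumes "0 \<le> \<phi>" "\<phi> \<le> pi/2"
  shows "integrable quarter (sqrt_pole \<phi>)" "integral\<^sup>L quarter (sqrt_pole \<phi>) \<le> 3"
proof -
  have "(sqrt_pole \<phi> has_integral (sqrt (pi/2 - \<phi>) - sqrt (0 - \<phi>))) {0..pi/2}"
  proof (rule fundamental_theorem_of_calculus_interior_strong[of "{\<phi>}"])
    fix x assume x: "x \<in> {0<..<pi/2} - {\<phi>}"
    have "((\<lambda>x. sqrt (x - \<phi>)) has_real_derivative sqrt_pole \<phi> x * 1) (at x)"
      using x by (intro DERIV_chain2[OF DERIV_real_sqrt_generic])
        (auto intro!: derivative_eq_intros simp: sqrt_pole_def field_simps abs_if real_sqrt_minus[symmetric])
    then show "((\<lambda>x. sqrt (x - \<phi>)) has_vector_derivative sqrt_pole \<phi> x) (at x)"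
      by (simp add: has_real_derivative_iff_has_vector_derivative)
  qed (auto intro!: continuous_intros)
  then have "((\<lambda>x. sqrt_pole \<phi> x * indicator {0..pi/2} x) has_integral (sqrt (pi/2 - \<phi>) - sqrt (0 - \<phi>))) UNIV"
    by (subst (asm) has_integral_restrict_UNIV[symmetric])
       (simp add: indicator_def if_distrib of_bool_def cong: if_cong)
  then have "(\<integral>\<^sup>+x. ennreal (sqrt_pole \<phi> x * indicator {0..pi/2} x) \<partial>lborel)
      = ennreal (sqrt (pi/2 - \<phi>) - sqrt (0 - \<phi>))"
    by (intro nn_integral_has_integral_lborel) (auto simp: sqrt_pole_def)
  then have nn: "(\<integral>\<^sup>+x. ennreal (sqrt_pole \<phi> x) \<partial>quarter) = ennreal (sqrt (pi/2 - \<phi>) + sqrt \<phi>)"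
    by (simp add: nn_integral_quarter ennreal_mult'' ennreal_indicator real_sqrt_minus)
  have meas: "sqrt_pole \<phi> \<in> borel_measurable quarter"
    unfolding sqrt_pole_def by (intro measurable_restrict_space1) measurable
  show int: "integrable quarter (sqrt_pole \<phi>)"
    by (rule integrableI_nn_integral_finite[OF meas _ nn]) (auto simp: sqrt_pole_def)
  have "sqrt (pi/2 - \<phi>) \<le> sqrt 2" "sqrt \<phi> \<le> sqrt 2"
    using assms pi_less_4 by (auto intro: real_sqrt_le_mono)
  moreover have "sqrt 2 \<le> (3/2::real)" by (rule real_le_lsqrt) (auto simp: power2_eq_square)
  moreover have "integral\<^sup>L quarter (sqrt_pole \<phi>) = sqrt (pi/2 - \<phi>) + sqrt \<phi>"
  proof -
    have "integral\<^sup>L quarter (sqrt_pole \<phi>) = enn2real (\<integral>\<^sup>+x. ennreal (sqrt_pole \<phi> x) \<partial>quarter)"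
      by (rule integral_eq_nn_integral[OF meas]) (simp add: sqrt_pole_def)
    also have "\<dots> = sqrt (pi/2 - \<phi>) + sqrt \<phi>"
      unfolding nn using assms by (intro enn2real_ennreal) auto
    finally show ?thesis .
  qed
  ultimately show "integral\<^sup>L quarter (sqrt_pole \<phi>) \<le> 3" by linarith
qed

text \<open>The point \<open>\<theta> = \<phi>\<close> is excluded: there the pole has the value \<open>0\<close> because of division by zero.\<close>

lemma exp_sqrt_pole_le_sq:
  assumes "\<theta> \<noteq> \<phi>"
  shows "exp (- 8 * sqrt_pole \<phi> \<theta>) \<le> (\<theta> - \<phi>)\<^sup>2"
proof -
  define r where "r = sqrt \<bar>\<theta> - \<phi>\<bar>"
  have r: "r > 0" using assms by (simp add: r_def)
  have "ln (1/r) \<le> 1/r - 1" using r by (intro ln_le_minus_one) auto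
  then have "- 4/r \<le> 4 * ln r" using r by (simp add: ln_div)
  then have "exp (-4/r) \<le> exp (4 * ln r)" by simp
  also have "\<dots> = r ^ 4" using r by (metis exp_ln exp_of_nat_mult of_nat_numeral)
  also have "r ^ 4 = (r\<^sup>2)\<^sup>2" by simp
  also have "\<dots> = (\<theta> - \<phi>)\<^sup>2" by (simp add: r_def)
  also have "-4/r = - 8 * sqrt_pole \<phi> \<theta>" by (simp add: sqrt_pole_def r_def)
  finally show ?thesis .
qed

text \<open>Jensen's inequality for the exponential function, from \<open>1 + x \<le> exp x\<close> at \<open>x = g \<theta> - m\<close> with \<open>m\<close> the
  mean of \<open>g\<close>. The bound \<open>c\<close> on the integral is also one on the mean because \<open>c \<le> 0\<close> and the total mass
  \<open>pi / 2\<close> exceeds \<open>1\<close>, which removes the normalization from all later estimates.\<close>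

lemma exp_mean_le_mean_exp:
  assumes g: "integrable quarter g" and c: "c \<le> 0" "c \<le> integral\<^sup>L quarter g"
  shows "ennreal (exp c) \<le> (\<integral>\<^sup>+\<theta>. ennreal (exp (g \<theta>)) \<partial>quarter)"
proof -
  interpret finite_measure quarter by (rule finite_measure_quarter)
  define m where "m = integral\<^sup>L quarter g / (pi/2)"
  have "exp c \<le> (pi/2) * exp m"
  proof -
    have "c \<le> m"
    proof (cases "integral\<^sup>L quarter g \<le> 0")
      case True
      have "integral\<^sup>L quarter g \<le> m"
        using True pi_gt3 mult_right_mono_neg[of 2 pi "integral\<^sup>L quarter g"]
        by (auto simp: m_def field_simps)
      then show ?thesis using c by simp
    next
      case False
      then have "m \<ge> 0" by (simp add: m_def)
      then show ?thesis using c by simp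
    qed
    then have "exp c \<le> 1 * exp m" by simp
    also have "\<dots> \<le> (pi/2) * exp m" using pi_gt3 by (intro mult_right_mono) auto
    finally show ?thesis .
  qed
  also have "(pi/2) * exp m = (\<integral>\<theta>. exp m * (1 + g \<theta> - m) \<partial>quarter)"
  proof -
    have "(\<integral>\<theta>. exp m * (1 + g \<theta> - m) \<partial>quarter) = exp m * (pi/2 + integral\<^sup>L quarter g - pi/2 * m)"
      using g by (simp add: measure_quarter space_restrict_space)
    moreover have "integral\<^sup>L quarter g = pi/2 * m" by (simp add: m_def)
    ultimately show ?thesis by simp
  qed
  finally have "ennreal (exp c) \<le> ennreal (\<integral>\<theta>. exp m * (1 + g \<theta> - m) \<partial>quarter)"
    by (rule ennreal_leI)
  also have "\<dots> \<le> ennreal (\<integral>\<theta>. max 0 (exp m * (1 + g \<theta> - m)) \<partial>quarter)"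
    using g by (intro ennreal_leI integral_mono) auto
  also have "\<dots> = (\<integral>\<^sup>+\<theta>. ennreal (max 0 (exp m * (1 + g \<theta> - m))) \<partial>quarter)"
    using g by (intro nn_integral_eq_integral[symmetric]) auto
  also have "\<dots> \<le> (\<integral>\<^sup>+\<theta>. ennreal (exp (g \<theta>)) \<partial>quarter)"
  proof (intro nn_integral_mono ennreal_leI max.boundedI)
    fix \<theta>
    have "exp m * (1 + (g \<theta> - m)) \<le> exp m * exp (g \<theta> - m)"
      by (intro mult_left_mono exp_ge_add_one_self) auto
    then show "exp m * (1 + g \<theta> - m) \<le> exp (g \<theta>)"
      by (simp add: exp_add[symmetric] algebra_simps)
  qed auto
  finally show ?thesis .
qed

section \<open>Polynomials inside and outside an interval\<close>

text \<open>The product of the factors \<open>z - a\<close> at \<open>z = R * cos \<theta>\<close> and at its negative is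
  \<open>R\<^sup>2 * (b - cos\<^sup>2 \<theta>)\<close> with \<open>b = (a / R)\<^sup>2\<close>. Up to absolute constants, \<open>A\<close> is the square of
  \<open>max R \<bar>a\<bar>\<close>: this is the size of the factor at points \<open>x\<close> of modulus \<open>R\<close>, and also its geometric mean
  over the interval, since the only possible zero on the interval is logarithmically integrable.\<close>

lemma linear_factor_on_quarter:
  fixes a :: complex
  assumes R: "R > 0"
  obtains A g where "0 \<le> A" "integrable quarter g" "-24 \<le> integral\<^sup>L quarter g"
    "AE \<theta> in quarter. A * exp (g \<theta>) \<le>
       cmod (of_real (R * cos \<theta>) - a) * cmod (of_real (- (R * cos \<theta>)) - a)"
    "\<And>x. R \<le> \<bar>x\<bar> \<Longrightarrow> (cmod (of_real x - a))\<^sup>2 \<le> A * (32 * (x/R)\<^sup>2)"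
proof -
  define b where "b = (a / of_real R)\<^sup>2"
  obtain \<phi> where \<phi>: "0 \<le> \<phi>" "\<phi> \<le> pi/2"
    "\<And>\<theta>. 0 \<le> \<theta> \<Longrightarrow> \<theta> \<le> pi/2 \<Longrightarrow>
       max 1 (cmod b) * (\<theta> - \<phi>)\<^sup>2 / 8 \<le> cmod (complex_of_real ((cos \<theta>)\<^sup>2) - b)"
    using cos_sq_diff_lower_bound[of b] by blast
  define A where "A = R\<^sup>2 * max 1 (cmod b) / 8"
  define g where "g = (\<lambda>\<theta>. - 8 * sqrt_pole \<phi> \<theta>)"
  have A0: "0 \<le> A" by (simp add: A_def)
  show thesis
  proof (rule that[OF A0])
    show "integrable quarter g" "-24 \<le> integral\<^sup>L quarter g"
      using sqrt_pole_integrable[OF \<phi>(1,2)] by (auto simp: g_def)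
    have "A * exp (g \<theta>) \<le> cmod (of_real (R * cos \<theta>) - a) * cmod (of_real (- (R * cos \<theta>)) - a)"
      if \<theta>: "0 \<le> \<theta>" "\<theta> \<le> pi/2" "\<theta> \<noteq> \<phi>" for \<theta>
    proof -
      have "A * exp (g \<theta>) \<le> A * (\<theta> - \<phi>)\<^sup>2"
        using exp_sqrt_pole_le_sq[OF \<theta>(3)] A0 by (auto simp: g_def intro: mult_left_mono)
      also have "\<dots> = R\<^sup>2 * (max 1 (cmod b) * (\<theta> - \<phi>)\<^sup>2 / 8)" by (simp add: A_def)
      also have "\<dots> \<le> R\<^sup>2 * cmod (complex_of_real ((cos \<theta>)\<^sup>2) - b)"
        using \<phi>(3)[OF \<theta>(1,2)] by (intro mult_left_mono) auto
      also have "\<dots> = cmod (of_real (R\<^sup>2) * (complex_of_real ((cos \<theta>)\<^sup>2) - b))"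
        by (simp add: norm_mult norm_power)
      also have "of_real (R\<^sup>2) * (complex_of_real ((cos \<theta>)\<^sup>2) - b)
          = - ((of_real (R * cos \<theta>) - a) * (of_real (- (R * cos \<theta>)) - a))"
        using R by (simp add: b_def field_simps power2_eq_square)
      finally show ?thesis by (simp add: norm_mult)
    qed
    moreover have "AE \<theta> in lborel. \<theta> \<noteq> \<phi>" by (rule AE_lborel_singleton)
    ultimately show "AE \<theta> in quarter. A * exp (g \<theta>) \<le>
       cmod (of_real (R * cos \<theta>) - a) * cmod (of_real (- (R * cos \<theta>)) - a)"
      unfolding AE_quarter by auto
    fix x :: real assume x: "R \<le> \<bar>x\<bar>"
    define u where "u = \<bar>x\<bar> / R"
    define v where "v = cmod a / R"
    have u: "1 \<le> u" using x R by (simp add: u_def)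
    have v: "0 \<le> v" "cmod b = v\<^sup>2" using R by (auto simp: v_def b_def norm_divide norm_power)
    have "cmod (of_real x - a) \<le> \<bar>x\<bar> + cmod a"
      using norm_triangle_ineq4[of "of_real x" a] by simp
    also have "\<dots> = R * (u + v)" using R by (simp add: u_def v_def field_simps)
    also have "\<dots> \<le> R * (u * (1 + v))"
      using R u v mult_right_mono[of 1 u v] by (intro mult_left_mono) (auto simp: algebra_simps)
    also have "\<dots> \<le> R * (u * (2 * max 1 v))" using R u v by (intro mult_left_mono) auto
    finally have "(cmod (of_real x - a))\<^sup>2 \<le> (R * (u * (2 * max 1 v)))\<^sup>2"
      by (intro power_mono) auto
    also have "\<dots> = R\<^sup>2 * (max 1 v)\<^sup>2 * (4 * u\<^sup>2)" by (simp add: power_mult_distrib)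
    also have "(max 1 v)\<^sup>2 = max 1 (cmod b)"
    proof (cases "v \<le> 1")
      case True
      then show ?thesis using v power_le_one[of v 2] by (simp add: max_absorb1)
    next
      case False
      then show ?thesis using v one_le_power[of v 2] by (simp add: max_absorb2)
    qed
    also have "R\<^sup>2 * max 1 (cmod b) * (4 * u\<^sup>2) = A * (32 * (x/R)\<^sup>2)"
      by (simp add: A_def u_def power_divide)
    finally show "(cmod (of_real x - a))\<^sup>2 \<le> A * (32 * (x/R)\<^sup>2)" .
  qed
qed

text \<open>Multiplying the bounds for the linear factors: both the size of \<open>p\<close> outside \<open>[-R,R]\<close> and its geometric
  mean over \<open>[-R,R]\<close> are compared with one constant \<open>A\<close>, which depends on \<open>p\<close> and drops out later. The
  loss is exponential in the degree, with an absolute rate.\<close>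

lemma poly_on_quarter:
  fixes p :: "complex poly"
  assumes R: "R > 0" and p: "p \<noteq> 0"
  shows "\<exists>A g. 0 \<le> A \<and> integrable quarter g \<and> -24 * real (degree p) \<le> integral\<^sup>L quarter g \<and>
    (AE \<theta> in quarter. A * exp (g \<theta>) \<le>
       cmod (poly p (of_real (R * cos \<theta>))) * cmod (poly p (of_real (- (R * cos \<theta>))))) \<and>
    (\<forall>x. R \<le> \<bar>x\<bar> \<longrightarrow> (cmod (poly p (of_real x)))\<^sup>2 \<le> A * (32 * (x/R)\<^sup>2) ^ degree p)"
  using p
proof (induction "degree p" arbitrary: p)
  case 0
  then obtain c where p: "p = [:c:]" using degree_0_id by metis
  show ?case
    by (rule exI[of _ "(cmod c)\<^sup>2"], rule exI[of _ "\<lambda>_. 0"]) (simp add: p power2_eq_square)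
next
  case (Suc m)
  then obtain a where "poly p a = 0"
    using fundamental_theorem_of_algebra[of p] by (auto simp: constant_degree)
  then obtain q where q: "p = [:-a, 1:] * q" by (auto simp: poly_eq_0_iff_dvd)
  with Suc.prems have q0: "q \<noteq> 0" by auto
  have deg: "degree p = Suc (degree q)"
    using q0 unfolding q by (subst degree_mult_eq) auto
  with Suc.hyps have "m = degree q" by simp
  from Suc.hyps(1)[OF this q0] obtain A g where 1: "0 \<le> A" "integrable quarter g"
    "-24 * real (degree q) \<le> integral\<^sup>L quarter g"
    "AE \<theta> in quarter. A * exp (g \<theta>) \<le>
       cmod (poly q (of_real (R * cos \<theta>))) * cmod (poly q (of_real (- (R * cos \<theta>))))"
    "\<And>x. R \<le> \<bar>x\<bar> \<Longrightarrow> (cmod (poly q (of_real x)))\<^sup>2 \<le> A * (32 * (x/R)\<^sup>2) ^ degree q"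
    by blast
  obtain A' g' where 2: "0 \<le> A'" "integrable quarter g'" "-24 \<le> integral\<^sup>L quarter g'"
    "AE \<theta> in quarter. A' * exp (g' \<theta>) \<le>
       cmod (of_real (R * cos \<theta>) - a) * cmod (of_real (- (R * cos \<theta>)) - a)"
    "\<And>x. R \<le> \<bar>x\<bar> \<Longrightarrow> (cmod (of_real x - a))\<^sup>2 \<le> A' * (32 * (x/R)\<^sup>2)"
    using linear_factor_on_quarter[OF R, of a] by blast
  have pq: "poly p z = (z - a) * poly q z" for z by (simp add: q algebra_simps)
  show ?case
  proof (intro exI[of _ "A' * A"] exI[of _ "\<lambda>\<theta>. g' \<theta> + g \<theta>"] conjI allI impI)
    show "AE \<theta> in quarter. A' * A * exp (g' \<theta> + g \<theta>) \<le>
       cmod (poly p (of_real (R * cos \<theta>))) * cmod (poly p (of_real (- (R * cos \<theta>))))"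
      using 1(4) 2(4)
    proof eventually_elim
      case (elim \<theta>)
      have "(A' * exp (g' \<theta>)) * (A * exp (g \<theta>)) \<le>
        (cmod (of_real (R * cos \<theta>) - a) * cmod (of_real (- (R * cos \<theta>)) - a)) *
        (cmod (poly q (of_real (R * cos \<theta>))) * cmod (poly q (of_real (- (R * cos \<theta>)))))"
        by (intro mult_mono elim mult_nonneg_nonneg 1(1) 2(1)) simp_all
      then show ?case by (simp only: pq norm_mult exp_add mult_ac)
    qed
    fix x assume "R \<le> \<bar>x\<bar>"
    then have "(cmod (of_real x - a))\<^sup>2 * (cmod (poly q (of_real x)))\<^sup>2
        \<le> (A' * (32 * (x/R)\<^sup>2)) * (A * (32 * (x/R)\<^sup>2) ^ degree q)"
      using 1 2 by (intro mult_mono) auto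
    then show "(cmod (poly p (of_real x)))\<^sup>2 \<le> A' * A * (32 * (x/R)\<^sup>2) ^ degree p"
      by (simp only: deg pq norm_mult power_mult_distrib mult_ac power_Suc)
  next
    show "0 \<le> A' * A" using 1(1) 2(1) by simp
    show "integrable quarter (\<lambda>\<theta>. g' \<theta> + g \<theta>)" using 1(2) 2(2) by simp
    show "-24 * real (degree p) \<le> (\<integral>\<theta>. g' \<theta> + g \<theta> \<partial>quarter)"
      using 1(2,3) 2(2,3) by (simp add: deg)
  qed
qed

section \<open>The restricted range inequality\<close>

lemma nn_integral_lborel_reflect:
  fixes f :: "real \<Rightarrow> ennreal"
  assumes "f \<in> borel_measurable borel"
  shows "(\<integral>\<^sup>+x. f (- x) \<partial>lborel) = (\<integral>\<^sup>+x. f x \<partial>lborel)"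
  using nn_integral_real_affine[OF assms, of "-1" 0] by simp

lemma nn_integral_cos_substitution:
  fixes F :: "real \<Rightarrow> ennreal"
  assumes F[measurable]: "F \<in> borel_measurable borel" and R: "0 \<le> R"
  shows "(\<integral>\<^sup>+\<theta>. F (R * cos \<theta>) * ennreal (R * sin \<theta>) \<partial>quarter) = (\<integral>\<^sup>+s\<in>{0..R}. F s \<partial>lborel)"
proof -
  have "(\<integral>\<^sup>+x. F (- x) * indicator {- R * cos 0..- R * cos (pi/2)} x \<partial>lborel) =
      (\<integral>\<^sup>+x. F (- (- R * cos x)) * ennreal (R * sin x) * indicator {0..pi/2} x \<partial>lborel)"
  proof (rule nn_integral_substitution_aux)
    show "((\<lambda>x. - R * cos x) has_real_derivative R * sin x) (at x)" for x
      by (auto intro!: derivative_eq_intros)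
    show "0 \<le> R * sin x" if "x \<in> {0..pi/2}" for x
      using that R by (auto intro!: mult_nonneg_nonneg sin_ge_zero)
  qed (auto intro!: continuous_intros)
  also have "(\<integral>\<^sup>+x. F (- x) * indicator {- R * cos 0..- R * cos (pi/2)} x \<partial>lborel)
      = (\<integral>\<^sup>+x. F (- x) * indicator {0..R} (- x) \<partial>lborel)"
    by (intro nn_integral_cong) (auto simp: indicator_def)
  also have "\<dots> = (\<integral>\<^sup>+s\<in>{0..R}. F s \<partial>lborel)"
    by (rule nn_integral_lborel_reflect) measurable
  finally show ?thesis by (simp add: nn_integral_quarter)
qed

text \<open>The restricted range inequality. Outside \<open>[-R,R]\<close> the polynomial is bounded by its geometric mean over
  \<open>[-R,R]\<close>. Inserting the weight into that mean costs the mean of \<open>Q (R * cos \<theta>)\<close>, which is at most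
  \<open>L * R + m\<close> plus the excess of \<open>Q s - L * s\<close> over the constant \<open>m\<close>. By Jensen's inequality the
  weighted geometric mean is at most the arithmetic one. The additional factor \<open>R * sin \<theta>\<close>, needed to return from
  \<open>d\<theta>\<close> to \<open>ds\<close>, is itself treated as a polynomial with a root at \<open>\<theta> = 0\<close>, because
  \<open>sin \<theta> \<ge> sin\<^sup>2 \<theta> = 1 - cos\<^sup>2 \<theta>\<close>.\<close>

lemma poly_outside_bound:
  fixes p :: "complex poly" and Q :: "real \<Rightarrow> real"
  assumes Q[measurable]: "Q \<in> borel_measurable borel"
    and R: "R > 0" and deg: "degree p \<le> n" and L: "0 \<le> L" and H: "0 \<le> H"
    and osc: "(\<integral>\<^sup>+\<theta>. ennreal (Q (R * cos \<theta>) - L * (R * cos \<theta>) - m) \<partial>quarter) \<le> ennreal H"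
    and x: "R \<le> \<bar>x\<bar>"
  shows "ennreal ((cmod (poly p (of_real x)))\<^sup>2) \<le>
    ennreal ((32 * (x/R)\<^sup>2) ^ n * (8/R) * exp (L * R + m + 24 * real n + 24 + H)) *
      (\<integral>\<^sup>+s\<in>{-R..R}. ennreal ((cmod (poly p (of_real s)))\<^sup>2 * exp (- Q \<bar>s\<bar>)) \<partial>lborel)"
    (is "_ \<le> _ * ?J")
proof (cases "p = 0")
  case True
  then show ?thesis by simp
next
  case p0: False
  have [measurable]: "(\<lambda>s. poly p (complex_of_real s)) \<in> borel_measurable borel"
    by (intro borel_measurable_continuous_onI continuous_intros)
  obtain A g where g: "0 \<le> A" "integrable quarter g" "-24 * real (degree p) \<le> integral\<^sup>L quarter g"
    "AE \<theta> in quarter. A * exp (g \<theta>) \<le>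
       cmod (poly p (of_real (R * cos \<theta>))) * cmod (poly p (of_real (- (R * cos \<theta>))))"
    "\<And>x. R \<le> \<bar>x\<bar> \<Longrightarrow> (cmod (poly p (of_real x)))\<^sup>2 \<le> A * (32 * (x/R)\<^sup>2) ^ degree p"
    using poly_on_quarter[OF R p0] by blast
  obtain \<phi> where \<phi>: "0 \<le> \<phi>" "\<phi> \<le> pi/2"
    "\<And>\<theta>. 0 \<le> \<theta> \<Longrightarrow> \<theta> \<le> pi/2 \<Longrightarrow>
       max 1 (cmod 1) * (\<theta> - \<phi>)\<^sup>2 / 8 \<le> cmod (complex_of_real ((cos \<theta>)\<^sup>2) - 1)"
    using cos_sq_diff_lower_bound[of 1] by blast
  define k where "k = (\<lambda>\<theta>. max 0 (Q (R * cos \<theta>) - L * (R * cos \<theta>) - m))"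
  define G where "G = (\<lambda>\<theta>. g \<theta> + (- 8 * sqrt_pole \<phi> \<theta>) - k \<theta>)"
  have k_meas: "k \<in> borel_measurable quarter"
    unfolding k_def by (intro measurable_restrict_space1) measurable
  have k_nn: "(\<integral>\<^sup>+\<theta>. ennreal (k \<theta>) \<partial>quarter) \<le> ennreal H"
    using osc by (simp add: k_def ennreal_max_0)
  have k_int: "integrable quarter k"
    using k_meas le_less_trans[OF k_nn ennreal_less_top]
    by (intro integrableI_nonneg) (auto simp: k_def)
  have "ennreal (integral\<^sup>L quarter k) \<le> ennreal H"
    using k_nn by (subst (asm) nn_integral_eq_integral[OF k_int]) (auto simp: k_def)
  then have k_le: "integral\<^sup>L quarter k \<le> H" using H by (simp add: ennreal_le_iff)
  have G_int: "integrable quarter G"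
    using g(2) k_int sqrt_pole_integrable[OF \<phi>(1,2)] by (simp add: G_def)
  define c where "c = - (24 * real n + 24 + H)"
  have "integral\<^sup>L quarter G
      = integral\<^sup>L quarter g + (- 8 * integral\<^sup>L quarter (sqrt_pole \<phi>)) - integral\<^sup>L quarter k"
    using g(2) k_int sqrt_pole_integrable[OF \<phi>(1,2)] by (simp add: G_def)
  moreover have "real (degree p) \<le> real n" using deg by simp
  ultimately have c: "c \<le> 0" "c \<le> integral\<^sup>L quarter G"
    using g(3) k_le sqrt_pole_integrable(2)[OF \<phi>(1,2)] H unfolding c_def by linarith+
  \<comment> \<open>On the quarter period, \<open>D * exp (G \<theta>)\<close> is a minorant of the even weighted product \<open>F\<close> times the Jacobian.\<close>
  define D where "D = A * (R/8) * exp (- (L * R + m))"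
  have D: "0 \<le> D" using g(1) R by (simp add: D_def)
  define F where "F = (\<lambda>s. ennreal (cmod (poly p (of_real s)) * cmod (poly p (of_real (- s))) * exp (- Q s)))"
  have F[measurable]: "F \<in> borel_measurable borel" unfolding F_def by measurable
  have low: "AE \<theta> in quarter. ennreal D * ennreal (exp (G \<theta>)) \<le> F (R * cos \<theta>) * ennreal (R * sin \<theta>)"
  proof -
    have "AE \<theta> in lborel. \<theta> \<noteq> \<phi>" by (rule AE_lborel_singleton)
    with g(4) show ?thesis unfolding AE_quarter
    proof eventually_elim
      case (elim \<theta>)
      show ?case
      proof
        assume \<theta>: "0 \<le> \<theta> \<and> \<theta> \<le> pi/2"
        have c0: "0 \<le> cos \<theta>" "cos \<theta> \<le> 1" and s0: "0 \<le> sin \<theta>" "sin \<theta> \<le> 1"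
          using \<theta> by (auto intro!: cos_ge_zero sin_ge_zero)
        have "complex_of_real ((cos \<theta>)\<^sup>2) - 1 = of_real (- (sin \<theta>)\<^sup>2)"
          by (simp add: cos_squared_eq)
        then have "cmod (complex_of_real ((cos \<theta>)\<^sup>2) - 1) = (sin \<theta>)\<^sup>2"
          by (simp add: norm_power del: of_real_power)
        moreover have "(sin \<theta>)\<^sup>2 \<le> sin \<theta>"
          using s0 mult_left_mono[of "sin \<theta>" 1 "sin \<theta>"] by (simp add: power2_eq_square)
        ultimately have "(\<theta> - \<phi>)\<^sup>2 / 8 \<le> sin \<theta>" using \<phi>(3)[of \<theta>] \<theta> by simp
        with exp_sqrt_pole_le_sq[of \<theta> \<phi>] elim(2)
        have sin: "exp (- 8 * sqrt_pole \<phi> \<theta>) / 8 \<le> sin \<theta>" by linarith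
        have "L * (R * cos \<theta>) \<le> L * R"
          using c0 R L mult_left_mono[of "cos \<theta>" 1 "L * R"] by simp
        then have "- (L * R + m) - k \<theta> \<le> - Q (R * cos \<theta>)" by (auto simp: k_def)
        then have Qe: "exp (- (L * R + m) - k \<theta>) \<le> exp (- Q (R * cos \<theta>))" by simp
        have "D * exp (G \<theta>) = (A * exp (g \<theta>)) * exp (- (L * R + m) - k \<theta>)
            * (R * (exp (- 8 * sqrt_pole \<phi> \<theta>) / 8))"
          by (simp add: D_def G_def exp_add exp_diff exp_minus field_simps)
        also have "\<dots> \<le> (cmod (poly p (of_real (R * cos \<theta>))) * cmod (poly p (of_real (- (R * cos \<theta>)))))
            * exp (- Q (R * cos \<theta>)) * (R * sin \<theta>)"
          using R s0(1)
          by (intro mult_mono[OF mult_mono[OF elim(1)[rule_format, OF \<theta>] Qe] mult_left_mono[OF sin]]) auto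
        finally show "ennreal D * ennreal (exp (G \<theta>)) \<le> F (R * cos \<theta>) * ennreal (R * sin \<theta>)"
          using D R s0 unfolding F_def
          by (subst (1 2) ennreal_mult''[symmetric]) (auto intro!: ennreal_leI)
      qed
    qed
  qed
  define a where "a = (\<lambda>s. ennreal ((cmod (poly p (of_real s)))\<^sup>2 * exp (- Q \<bar>s\<bar>)))"
  have a[measurable]: "a \<in> borel_measurable borel" unfolding a_def by measurable
  have "ennreal (D * exp c) \<le> ennreal D * (\<integral>\<^sup>+\<theta>. ennreal (exp (G \<theta>)) \<partial>quarter)"
    using exp_mean_le_mean_exp[OF G_int c] D by (simp add: ennreal_mult mult_left_mono)
  also have "\<dots> = (\<integral>\<^sup>+\<theta>. ennreal D * ennreal (exp (G \<theta>)) \<partial>quarter)"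
    by (intro nn_integral_cmult[symmetric] measurable_compose[OF borel_measurable_integrable[OF G_int]])
      measurable
  also have "\<dots> \<le> (\<integral>\<^sup>+\<theta>. F (R * cos \<theta>) * ennreal (R * sin \<theta>) \<partial>quarter)"
    by (rule nn_integral_mono_AE[OF low])
  also have "\<dots> = (\<integral>\<^sup>+s\<in>{0..R}. F s \<partial>lborel)"
    using R by (intro nn_integral_cos_substitution) auto
  also have "\<dots> \<le> (\<integral>\<^sup>+s. ennreal (1/2) * (a s * indicator {-R..R} s)
      + ennreal (1/2) * (a (- s) * indicator {-R..R} (- s)) \<partial>lborel)"
  proof (rule nn_integral_mono)
    fix s :: real
    have "F s \<le> ennreal (1/2) * a s + ennreal (1/2) * a (- s)" if "0 \<le> s"
    proof -
      define u v where "u = cmod (poly p (of_real s))" and "v = cmod (poly p (of_real (- s)))"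
      have "u * v \<le> 1/2 * u\<^sup>2 + 1/2 * v\<^sup>2" using sum_squares_bound[of u v] by simp
      then have "u * v * exp (- Q s) \<le> (1/2 * u\<^sup>2 + 1/2 * v\<^sup>2) * exp (- Q s)"
        by (intro mult_right_mono) auto
      also have "\<dots> = 1/2 * (u\<^sup>2 * exp (- Q s)) + 1/2 * (v\<^sup>2 * exp (- Q s))"
        by (simp add: algebra_simps)
      finally have "F s \<le> ennreal (1/2 * (u\<^sup>2 * exp (- Q s)) + 1/2 * (v\<^sup>2 * exp (- Q s)))"
        unfolding F_def u_def v_def by (rule ennreal_leI)
      also have "\<dots> = ennreal (1/2) * ennreal (u\<^sup>2 * exp (- Q s)) + ennreal (1/2) * ennreal (v\<^sup>2 * exp (- Q s))"
      proof -
        have "0 \<le> 1/2 * (u\<^sup>2 * exp (- Q s))" "0 \<le> 1/2 * (v\<^sup>2 * exp (- Q s))" "0 \<le> (1/2::real)"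
          by simp_all
        then show ?thesis by (simp only: ennreal_plus ennreal_mult')
      qed
      finally show ?thesis using that by (simp add: a_def u_def v_def)
    qed
    then show "F s * indicator {0..R} s \<le> ennreal (1/2) * (a s * indicator {-R..R} s)
      + ennreal (1/2) * (a (- s) * indicator {-R..R} (- s))"
      by (cases "s \<in> {0..R}") simp_all
  qed
  also have "\<dots> = ennreal (1/2) * (\<integral>\<^sup>+s\<in>{-R..R}. a s \<partial>lborel)
      + ennreal (1/2) * (\<integral>\<^sup>+s. a (- s) * indicator {-R..R} (- s) \<partial>lborel)"
    by (subst nn_integral_add, measurable) (subst (1 2) nn_integral_cmult, measurable)
  also have "(\<integral>\<^sup>+s. a (- s) * indicator {-R..R} (- s) \<partial>lborel) = (\<integral>\<^sup>+s\<in>{-R..R}. a s \<partial>lborel)"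
    by (rule nn_integral_lborel_reflect) measurable
  also have "(\<integral>\<^sup>+s\<in>{-R..R}. a s \<partial>lborel) = ?J" unfolding a_def ..
  also have "ennreal (1/2) * ?J + ennreal (1/2) * ?J = ?J"
  proof -
    have "ennreal (1/2) + ennreal (1/2) = 1" by (subst ennreal_plus[symmetric]) simp_all
    then show ?thesis by (simp only: distrib_right[symmetric] mult_1_left)
  qed
  finally have J: "ennreal (D * exp c) \<le> ?J" .
  have "(cmod (poly p (of_real x)))\<^sup>2 \<le> A * (32 * (x/R)\<^sup>2) ^ degree p" by (rule g(5)[OF x])
  also have "\<dots> \<le> A * (32 * (x/R)\<^sup>2) ^ n"
  proof (intro mult_left_mono power_increasing deg g(1))
    have "1\<^sup>2 \<le> (\<bar>x\<bar>/R)\<^sup>2" using x R by (intro power_mono) auto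
    then show "1 \<le> 32 * (x/R)\<^sup>2" by (simp add: power_divide)
  qed
  also have "\<dots> = ((32 * (x/R)\<^sup>2) ^ n * (8/R) * exp (L * R + m + 24 * real n + 24 + H)) * (D * exp c)"
    using R by (simp add: D_def c_def exp_add exp_diff exp_minus field_simps)
  finally have "ennreal ((cmod (poly p (of_real x)))\<^sup>2)
     \<le> ennreal ((32 * (x/R)\<^sup>2) ^ n * (8/R) * exp (L * R + m + 24 * real n + 24 + H)) * ennreal (D * exp c)"
    using R D by (subst ennreal_mult[symmetric]) (auto intro!: ennreal_leI)
  also have "\<dots> \<le> ennreal ((32 * (x/R)\<^sup>2) ^ n * (8/R) * exp (L * R + m + 24 * real n + 24 + H)) * ?J"
    by (intro mult_left_mono J) auto
  finally show ?thesis .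
qed

section \<open>Exponential factors in one variable\<close>

lemma nn_integral_exp_neg_abs: "(\<integral>\<^sup>+x. ennreal (exp (- \<bar>x\<bar>)) \<partial>lborel) \<le> ennreal 2"
proof -
  define f where "f = (\<lambda>x :: real. ennreal (exp (- x)) * indicator {0..} x)"
  have [measurable]: "f \<in> borel_measurable borel" by (simp add: f_def)
  have "((\<lambda>x::real. - exp (- x)) \<longlongrightarrow> - 0) at_top"
    by (intro tendsto_intros filterlim_compose[OF exp_at_bot] filterlim_uminus_at_bot_at_top)
  then have f: "(\<integral>\<^sup>+x. f x \<partial>lborel) = ennreal (0 - - exp (- 0))"
    unfolding f_def
    by (intro nn_integral_FTC_atLeast) (auto intro!: derivative_eq_intros)
  have "(\<integral>\<^sup>+x. ennreal (exp (- \<bar>x\<bar>)) \<partial>lborel) \<le> (\<integral>\<^sup>+x. f x + f (- x) \<partial>lborel)"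
    by (intro nn_integral_mono) (auto simp: f_def indicator_def)
  also have "\<dots> = (\<integral>\<^sup>+x. f x \<partial>lborel) + (\<integral>\<^sup>+x. f (- x) \<partial>lborel)"
    by (intro nn_integral_add) measurable
  also have "\<dots> = ennreal 2"
    by (simp add: nn_integral_lborel_reflect f ennreal_plus[symmetric] del: ennreal_plus)
  finally show ?thesis .
qed

lemma sq_mult_exp_neg_half_le:
  fixes u :: real
  assumes "0 \<le> u"
  shows "u\<^sup>2 * exp (- u/2) \<le> 16"
proof -
  have "u/4 \<le> exp (u/4)" using exp_ge_add_one_self[of "u/4"] by linarith
  then have "(u/4)\<^sup>2 \<le> (exp (u/4))\<^sup>2" using assms by (intro power_mono) auto
  also have "(exp (u/4))\<^sup>2 = exp (u/2)" by (simp add: exp_double[symmetric])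
  finally have "u\<^sup>2 \<le> 16 * exp (u/2)" by (simp add: power_divide)
  then have "u\<^sup>2 * exp (- u/2) \<le> 16 * exp (u/2) * exp (- u/2)" by (intro mult_right_mono) auto
  then show ?thesis by (simp add: mult.assoc exp_add[symmetric])
qed

text \<open>What matters is only that this base does not depend on the weight, on the degree or on the exponential
  factor.\<close>

definition growth_const :: real where
  "growth_const = 512 * exp 26"

lemma growth_const_bounds: "1 \<le> growth_const" "0 < growth_const"
proof -
  have "(1::real) \<le> exp 26" by simp
  then show "1 \<le> growth_const" "0 < growth_const" unfolding growth_const_def by linarith+
qed

text \<open>The choice \<open>L * R = n\<close> balances all terms: with \<open>u = \<bar>x\<bar> / R\<close>, half of the linear decay
  \<open>L * \<bar>x\<bar> = n * u\<close> beats the growth \<open>u ^ (2 * n)\<close> of the polynomial, the other half absorbs the exponential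
  factor \<open>exp (2 * Y * \<bar>x\<bar>)\<close> and leaves \<open>exp (- \<bar>x\<bar>)\<close> for integrability. The value of \<open>m\<close> cancels, and
  \<open>ln R\<close> is compensated by the division by \<open>R\<close>.\<close>

lemma outside_exponent_bound:
  fixes x R L Y m B :: real and n :: nat
  assumes Y: "0 \<le> Y" and L: "L = 4*Y + 2" and R: "1 \<le> R" "L * R = real n"
    and x: "R \<le> \<bar>x\<bar>" and q: "L * \<bar>x\<bar> + m \<le> q"
  shows "(32 * (x/R)\<^sup>2) ^ n * (8/R) * exp (L * R + m + 24 * real n + 24 + (B + ln R)) *
      exp (2 * Y * \<bar>x\<bar> - q) \<le> 8 * exp (24 + B) * (512 * exp 25) ^ n * exp (- \<bar>x\<bar>)"
proof -
  define u where "u = \<bar>x\<bar>/R"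
  have u: "0 \<le> u" using R by (simp add: u_def)
  have xu: "L * \<bar>x\<bar> = real n * u" using R by (simp add: u_def field_simps)
  have u2: "(x/R)\<^sup>2 = u\<^sup>2" by (simp add: u_def power_divide)
  have "exp (L * R + m + 24 * real n + 24 + (B + ln R)) * exp (2 * Y * \<bar>x\<bar> - q)
      = R * (exp (24 + B) * exp (25 * real n) * exp (m + 2 * Y * \<bar>x\<bar> - q))"
    using R by (simp add: exp_add[symmetric] algebra_simps) (simp add: exp_add exp_diff)
  moreover have "exp (m + 2 * Y * \<bar>x\<bar> - q) \<le> exp (real n * (- u/2) - \<bar>x\<bar>)"
    using q xu L by (simp add: algebra_simps)
  ultimately have "exp (L * R + m + 24 * real n + 24 + (B + ln R)) * exp (2 * Y * \<bar>x\<bar> - q)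
      \<le> R * (exp (24 + B) * exp (25 * real n) * exp (real n * (- u/2) - \<bar>x\<bar>))"
    using R by (simp add: mult_left_mono)
  also have "\<dots> = R * (exp (24 + B) * exp 25 ^ n * (exp (- u/2) ^ n * exp (- \<bar>x\<bar>)))"
    by (simp only: exp_diff exp_minus divide_inverse exp_of_nat_mult[symmetric] mult.commute)
  finally have "(32 * u\<^sup>2) ^ n * (8/R) * (exp (L * R + m + 24 * real n + 24 + (B + ln R)) * exp (2 * Y * \<bar>x\<bar> - q))
      \<le> (32 * u\<^sup>2) ^ n * (8/R) * (R * (exp (24 + B) * exp 25 ^ n * (exp (- u/2) ^ n * exp (- \<bar>x\<bar>))))"
    using R by (intro mult_left_mono) auto
  also have "\<dots> = 8 * exp (24 + B) * exp 25 ^ n * exp (- \<bar>x\<bar>) * (32 * (u\<^sup>2 * exp (- u/2))) ^ n"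
    using R by (simp add: power_mult_distrib mult_ac)
  also have "\<dots> \<le> 8 * exp (24 + B) * exp 25 ^ n * exp (- \<bar>x\<bar>) * 512 ^ n"
    using sq_mult_exp_neg_half_le[OF u] by (intro mult_left_mono power_mono) auto
  also have "\<dots> = 8 * exp (24 + B) * (512 * exp 25) ^ n * exp (- \<bar>x\<bar>)"
    by (simp only: power_mult_distrib mult_ac)
  finally show ?thesis by (simp only: u2 mult.assoc)
qed

lemma AE_lborel_abs:
  assumes P: "AE s in lborel. P s"
  shows "AE x :: real in lborel. P \<bar>x\<bar>"
proof -
  obtain N where N: "{s. \<not> P s} \<subseteq> N" "N \<in> null_sets lborel"
    using P by (auto simp: eventually_ae_filter)
  then have [measurable]: "N \<in> sets borel" by auto
  have "AE x in lborel. x \<notin> N" by (rule AE_not_in[OF N(2)])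
  moreover from this have "AE x in lborel. - x \<notin> N"
    using AE_borel_affine[of "-1" "\<lambda>x. x \<notin> N" 0] by simp
  ultimately show ?thesis by eventually_elim (use N(1) in \<open>auto simp: abs_if\<close>)
qed

text \<open>On \<open>[-R,R]\<close> with \<open>R = n / L\<close> the exponential factors lie between \<open>exp (- n)\<close> and \<open>exp n\<close>, whatever
  \<open>Y\<close> is. Hence all three integrands are comparable there: those of the two sides and the one without exponential
  factor. The rest of the line is controlled by the restricted range inequality. The factor \<open>C\<close> may depend on \<open>Y\<close> and
  \<open>B\<close>, but \<open>n\<close>-th roots will remove it.\<close>

lemma weighted_poly_comparison_1d:
  fixes Q :: "real \<Rightarrow> real"
  assumes Q[measurable]: "Q \<in> borel_measurable borel" and Y: "0 \<le> Y" and L: "L = 4*Y + 2" and B: "0 \<le> B"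
    and minorant: "\<forall>\<^sub>F R in at_top. \<exists>m. (AE s in lborel. R \<le> s \<longrightarrow> L * s + m \<le> Q s) \<and>
      (\<integral>\<^sup>+\<theta>. ennreal (Q (R * cos \<theta>) - L * (R * cos \<theta>) - m) \<partial>quarter) \<le> ennreal (B + ln R)"
  shows "\<exists>C\<ge>0. \<forall>\<^sub>F n in sequentially. \<forall>p. degree p \<le> n \<longrightarrow>
    (\<integral>\<^sup>+x. ennreal ((cmod (poly p (of_real x)))\<^sup>2 * exp (2 * Y * \<bar>x\<bar> - Q \<bar>x\<bar>)) \<partial>lborel) \<le>
    ennreal (C * growth_const ^ n) *
    (\<integral>\<^sup>+x. ennreal ((cmod (poly p (of_real x)))\<^sup>2 * exp (- (2 * Y * \<bar>x\<bar>) - Q \<bar>x\<bar>)) \<partial>lborel)"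
proof -
  have L0: "0 < L" using Y L by simp
  obtain R0 where R0: "\<And>R. R0 \<le> R \<Longrightarrow> \<exists>m. (AE s in lborel. R \<le> s \<longrightarrow> L * s + m \<le> Q s) \<and>
      (\<integral>\<^sup>+\<theta>. ennreal (Q (R * cos \<theta>) - L * (R * cos \<theta>) - m) \<partial>quarter) \<le> ennreal (B + ln R)"
    using minorant unfolding eventually_at_top_linorder by blast
  \<comment> \<open>The summands account for \<open>[-R,R]\<close> and for its complement.\<close>
  define C where "C = 1 + 16 * exp (24 + B)"
  show ?thesis
  proof (intro exI[of _ C] conjI)
    show "0 \<le> C" by (simp add: C_def)
    have "\<forall>\<^sub>F n in sequentially. max 1 R0 * L \<le> real n"
      by (rule eventually_sequentiallyI[of "nat \<lceil>max 1 R0 * L\<rceil>"]) linarith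
    then show "\<forall>\<^sub>F n in sequentially. \<forall>p. degree p \<le> n \<longrightarrow>
      (\<integral>\<^sup>+x. ennreal ((cmod (poly p (of_real x)))\<^sup>2 * exp (2 * Y * \<bar>x\<bar> - Q \<bar>x\<bar>)) \<partial>lborel) \<le>
      ennreal (C * growth_const ^ n) *
      (\<integral>\<^sup>+x. ennreal ((cmod (poly p (of_real x)))\<^sup>2 * exp (- (2 * Y * \<bar>x\<bar>) - Q \<bar>x\<bar>)) \<partial>lborel)"
    proof (eventually_elim, intro allI impI)
      fix n and p :: "complex poly"
      assume n: "max 1 R0 * L \<le> real n" and deg: "degree p \<le> n"
      define R where "R = real n / L"
      have "max 1 R0 \<le> R" using n by (simp only: R_def pos_le_divide_eq[OF L0])
      then have R1: "1 \<le> R" "R0 \<le> R" by auto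
      have LR: "L * R = real n" using L0 by (simp add: R_def)
      obtain m where m: "AE s in lborel. R \<le> s \<longrightarrow> L * s + m \<le> Q s"
        "(\<integral>\<^sup>+\<theta>. ennreal (Q (R * cos \<theta>) - L * (R * cos \<theta>) - m) \<partial>quarter) \<le> ennreal (B + ln R)"
        using R0[OF R1(2)] by blast
      have "2 * Y * R \<le> L * R" using R1 L Y by (intro mult_right_mono) auto
      with LR have YR: "2 * Y * R \<le> real n" by simp
      have [measurable]: "(\<lambda>s. poly p (complex_of_real s)) \<in> borel_measurable borel"
        by (intro borel_measurable_continuous_onI continuous_intros)
      define a where "a = (\<lambda>s. (cmod (poly p (of_real s)))\<^sup>2)"
      have [measurable]: "a \<in> borel_measurable borel" unfolding a_def by measurable
      have a0: "0 \<le> a s" for s by (simp add: a_def)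
      define J where "J = (\<integral>\<^sup>+s\<in>{-R..R}. ennreal (a s * exp (- Q \<bar>s\<bar>)) \<partial>lborel)"
      define D where "D = 8 * exp (24 + B) * (512 * exp 25) ^ n"
      have D0: "0 \<le> D" by (simp add: D_def)
      define I where "I = (\<integral>\<^sup>+x. ennreal (a x * exp (- (2 * Y * \<bar>x\<bar>) - Q \<bar>x\<bar>)) \<partial>lborel)"
      have Yx: "2 * Y * \<bar>x\<bar> \<le> real n" if "x \<in> {-R..R}" for x
      proof -
        have "2 * Y * \<bar>x\<bar> \<le> 2 * Y * R" using that Y by (intro mult_left_mono) auto
        with YR show ?thesis by simp
      qed
      have "AE x in lborel. ennreal (a x * exp (2 * Y * \<bar>x\<bar> - Q \<bar>x\<bar>)) \<le>
        ennreal (exp (real n)) * (ennreal (a x * exp (- Q \<bar>x\<bar>)) * indicator {-R..R} x)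
          + ennreal D * J * ennreal (exp (- \<bar>x\<bar>))"
      proof -
        have "AE x in lborel. R \<le> \<bar>x\<bar> \<longrightarrow> L * \<bar>x\<bar> + m \<le> Q \<bar>x\<bar>"
          by (rule AE_lborel_abs[OF m(1)])
        then show ?thesis
        proof eventually_elim
          case (elim x)
          show ?case
          proof (cases "x \<in> {-R..R}")
            case True
            have "a x * exp (2 * Y * \<bar>x\<bar> - Q \<bar>x\<bar>) \<le> a x * exp (real n - Q \<bar>x\<bar>)"
              using Yx[OF True] by (intro mult_left_mono a0) auto
            also have "\<dots> = exp (real n) * (a x * exp (- Q \<bar>x\<bar>))"
              by (simp add: exp_diff exp_minus field_simps)
            finally have "ennreal (a x * exp (2 * Y * \<bar>x\<bar> - Q \<bar>x\<bar>))
                \<le> ennreal (exp (real n)) * (ennreal (a x * exp (- Q \<bar>x\<bar>)) * indicator {-R..R} x)"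
              using True a0 by (simp add: ennreal_mult[symmetric] ennreal_leI)
            then show ?thesis by (rule order_trans) simp
          next
            case False
            then have x: "R \<le> \<bar>x\<bar>" by auto
            define w where "w = (32 * (x/R)\<^sup>2) ^ n * (8/R) * exp (L * R + m + 24 * real n + 24 + (B + ln R))"
            have w0: "0 \<le> w" using R1 by (simp add: w_def)
            have "ennreal (a x) \<le> ennreal w * J"
              unfolding a_def w_def J_def using R1 L0 B deg m(2) x
              by (intro poly_outside_bound) auto
            then have "ennreal (a x) * ennreal (exp (2 * Y * \<bar>x\<bar> - Q \<bar>x\<bar>))
                \<le> (ennreal w * J) * ennreal (exp (2 * Y * \<bar>x\<bar> - Q \<bar>x\<bar>))"
              by (rule mult_right_mono) simp
            also have "\<dots> = ennreal (w * exp (2 * Y * \<bar>x\<bar> - Q \<bar>x\<bar>)) * J"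
              using w0 by (simp add: ennreal_mult mult_ac)
            also have "\<dots> \<le> ennreal (D * exp (- \<bar>x\<bar>)) * J"
              unfolding w_def D_def using x elim
              by (intro mult_right_mono ennreal_leI outside_exponent_bound[OF Y L R1(1) LR]) auto
            also have "\<dots> = ennreal D * J * ennreal (exp (- \<bar>x\<bar>))"
              using D0 by (simp add: ennreal_mult mult_ac)
            finally show ?thesis using False a0 by (simp add: ennreal_mult)
            qed
      qed
      qed
      then have "(\<integral>\<^sup>+x. ennreal (a x * exp (2 * Y * \<bar>x\<bar> - Q \<bar>x\<bar>)) \<partial>lborel) \<le>
        (\<integral>\<^sup>+x. ennreal (exp (real n)) * (ennreal (a x * exp (- Q \<bar>x\<bar>)) * indicator {-R..R} x)
          + ennreal D * J * ennreal (exp (- \<bar>x\<bar>)) \<partial>lborel)"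
        by (rule nn_integral_mono_AE)
      also have "\<dots> = ennreal (exp (real n)) * J
          + ennreal D * J * (\<integral>\<^sup>+x. ennreal (exp (- \<bar>x\<bar>)) \<partial>lborel)"
        unfolding J_def by (subst nn_integral_add, measurable) (subst (1 2) nn_integral_cmult, measurable)
      also have "\<dots> \<le> ennreal (exp (real n)) * J + ennreal D * J * ennreal 2"
        by (intro add_left_mono mult_left_mono nn_integral_exp_neg_abs) auto
      also have "\<dots> = ennreal (exp (real n) + 2 * D) * J"
        using D0 by (simp add: ennreal_mult distrib_right distrib_left mult_ac)
      also have "J \<le> ennreal (exp (real n)) * I"
      proof -
        have "J \<le> (\<integral>\<^sup>+x. ennreal (exp (real n)) * ennreal (a x * exp (- (2 * Y * \<bar>x\<bar>) - Q \<bar>x\<bar>)) \<partial>lborel)"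
          unfolding J_def
        proof (intro nn_integral_mono)
          fix x
          show "ennreal (a x * exp (- Q \<bar>x\<bar>)) * indicator {-R..R} x
            \<le> ennreal (exp (real n)) * ennreal (a x * exp (- (2 * Y * \<bar>x\<bar>) - Q \<bar>x\<bar>))"
          proof (cases "x \<in> {-R..R}")
            case True
            have "a x * exp (- Q \<bar>x\<bar>) \<le> a x * exp (real n + (- (2 * Y * \<bar>x\<bar>) - Q \<bar>x\<bar>))"
              using Yx[OF True] by (intro mult_left_mono a0) auto
            also have "\<dots> = exp (real n) * (a x * exp (- (2 * Y * \<bar>x\<bar>) - Q \<bar>x\<bar>))"
              by (simp only: exp_add mult_ac)
            finally show ?thesis using True a0
              by (simp add: ennreal_mult[symmetric] ennreal_leI)
          qed simp
        qed
        also have "\<dots> = ennreal (exp (real n)) * I"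
          unfolding I_def by (rule nn_integral_cmult) measurable
        finally show ?thesis .
      qed
      also have "ennreal (exp (real n) + 2 * D) * (ennreal (exp (real n)) * I)
          = ennreal ((exp (real n) + 2 * D) * exp (real n)) * I"
        using D0 by (simp add: ennreal_mult mult_ac)
      also have "\<dots> \<le> ennreal (C * growth_const ^ n) * I"
      proof (intro mult_right_mono ennreal_leI)
        have e: "exp (real n) = exp 1 ^ n" by (simp add: exp_of_nat_mult[symmetric])
        have "exp (1::real) * exp 1 \<le> growth_const"
        proof -
          have "exp (1::real) * exp 1 = exp 2" by (simp add: exp_add[symmetric])
          also have "\<dots> \<le> exp 26" by simp
          also have "\<dots> \<le> growth_const" by (simp add: growth_const_def)
          finally show ?thesis .
        qed
        then have 1: "exp (real n) * exp (real n) \<le> growth_const ^ n"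
          unfolding e power_mult_distrib[symmetric] by (intro power_mono) auto
        have "512 * exp (25::real) * exp 1 = growth_const"
          by (simp add: growth_const_def exp_add[symmetric])
        then have 2: "D * exp (real n) = 8 * exp (24 + B) * growth_const ^ n"
          unfolding D_def e by (metis mult.assoc power_mult_distrib)
        show "(exp (real n) + 2 * D) * exp (real n) \<le> C * growth_const ^ n"
          using 1 2 by (simp add: C_def algebra_simps)
      qed simp
      finally show "(\<integral>\<^sup>+x. ennreal ((cmod (poly p (of_real x)))\<^sup>2 * exp (2 * Y * \<bar>x\<bar> - Q \<bar>x\<bar>)) \<partial>lborel) \<le>
        ennreal (C * growth_const ^ n) *
        (\<integral>\<^sup>+x. ennreal ((cmod (poly p (of_real x)))\<^sup>2 * exp (- (2 * Y * \<bar>x\<bar>) - Q \<bar>x\<bar>)) \<partial>lborel)"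
        by (simp add: a_def I_def mult_left_mono)
    qed
  qed
qed

section \<open>From the oscillation hypothesis to a linear minorant\<close>

text \<open>The essential infimum of \<open>Q s - L * s\<close> over \<open>[R,\<infinity>)\<close> serves as \<open>m\<close>. It is not \<open>-\<infinity>\<close>, for otherwise
  it would be \<open>-\<infinity>\<close> from every smaller point on as well and the oscillation would be infinite throughout \<open>[0,R]\<close>.
  It bounds the essential infima over the larger tails \<open>[R * cos \<theta>,\<infinity>)\<close> from above, so replacing them
  by the single number \<open>m\<close> only decreases the excess.\<close>

lemma ess_inf_tail_minorant:
  fixes Q :: "real \<Rightarrow> real"
  assumes Q: "Q \<in> borel_measurable (lebesgue_on {0..})" and R: "0 < R"
    and fin: "(\<integral>\<^sup>+\<theta>\<in>{0..pi/2}. e2ennreal (oscillation_part (shift_lin L Q) (R * cos \<theta>)) \<partial>lebesgue) < top"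
  obtains m where "AE s in lborel. R \<le> s \<longrightarrow> L * s + m \<le> Q s"
    "\<And>\<theta>. 0 \<le> \<theta> \<Longrightarrow> \<theta> \<le> pi/2 \<Longrightarrow> ennreal (Q (R * cos \<theta>) - L * (R * cos \<theta>) - m)
      \<le> e2ennreal (oscillation_part (shift_lin L Q) (R * cos \<theta>))"
proof -
  define q where "q = shift_lin L Q"
  define S where "S = (\<lambda>t T. {s. s \<ge> t \<and> T \<ge> q s})"
  define M where "M = ess_inf_tail q R"
  have "(\<lambda>t::real. L * t) \<in> borel_measurable (lebesgue_on {0..})"
    by (intro measurable_restrict_space1 measurable_completion) simp
  then have q: "q \<in> borel_measurable (lebesgue_on {0..})"
    using Q unfolding q_def shift_lin_def by (intro borel_measurable_diff)
  have S_meas: "S t T \<in> sets lebesgue" if "0 \<le> t" for t T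
  proof -
    have "q -` {..T} \<inter> space (lebesgue_on {0..}) \<in> sets (lebesgue_on {0..})"
      by (rule measurable_sets[OF q]) simp
    then have "q -` {..T} \<inter> {0..} \<in> sets lebesgue"
      by (subst (asm) sets_restrict_space_iff) auto
    moreover have "{t..} \<in> sets lebesgue" by (rule sets_completionI_sets) simp
    ultimately have "(q -` {..T} \<inter> {0..}) \<inter> {t..} \<in> sets lebesgue" by (rule sets.Int)
    moreover have "S t T = (q -` {..T} \<inter> {0..}) \<inter> {t..}" using that by (auto simp: S_def)
    ultimately show ?thesis by simp
  qed
  have mono: "ess_inf_tail q t \<le> M" if t: "0 \<le> t" "t \<le> R" for t
    unfolding M_def ess_inf_tail_def
  proof (rule INF_superset_mono)
    show "{T. 0 < emeasure lebesgue {s. R \<le> s \<and> q s \<le> T}} \<subseteq> {T. 0 < emeasure lebesgue {s. t \<le> s \<and> q s \<le> T}}"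
    proof safe
      fix T assume "0 < emeasure lebesgue {s. R \<le> s \<and> q s \<le> T}"
      also have "\<dots> \<le> emeasure lebesgue (S t T)"
        using t S_meas[OF t(1)] by (intro emeasure_mono) (auto simp: S_def)
      finally show "0 < emeasure lebesgue {s. t \<le> s \<and> q s \<le> T}" by (simp add: S_def)
    qed
  qed simp
  have null: "S R T \<in> null_sets lebesgue" if "ereal T < M" for T
  proof (rule ccontr)
    assume "S R T \<notin> null_sets lebesgue"
    then have "0 < emeasure lebesgue (S R T)"
      using S_meas[of R T] R by (auto simp: null_sets_def zero_less_iff_neq_zero)
    then have "M \<le> ereal T" unfolding M_def ess_inf_tail_def S_def by (intro INF_lower) simp
    with that show False by simp
  qed
  have "M \<noteq> \<infinity>"
  proof
    assume "M = \<infinity>"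
    then have "(\<Union>k::nat. S R (real k)) \<in> null_sets lebesgue"
      by (intro null_sets_UN null) simp
    moreover have "(\<Union>k::nat. S R (real k)) = {R..}"
      by (auto simp: S_def intro: real_arch_simple)
    ultimately have "emeasure lborel {R..} = 0" by (auto simp: null_sets_def)
    moreover have "emeasure lborel {R..R+1} \<le> emeasure lborel {R..}" by (intro emeasure_mono) auto
    ultimately show False by simp
  qed
  moreover have "M \<noteq> -\<infinity>"
  proof
    assume M: "M = -\<infinity>"
    have "oscillation_part q (R * cos \<theta>) = \<infinity>" if "\<theta> \<in> {0..pi/2}" for \<theta>
    proof -
      have "0 \<le> R * cos \<theta>" "R * cos \<theta> \<le> R"
        using that R by (auto intro!: mult_nonneg_nonneg cos_ge_zero)
      then have "ess_inf_tail q (R * cos \<theta>) = -\<infinity>" using mono M by simp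
      then show ?thesis by (simp add: oscillation_part_def)
    qed
    then have "(\<integral>\<^sup>+\<theta>\<in>{0..pi/2}. e2ennreal (oscillation_part q (R * cos \<theta>)) \<partial>lebesgue)
      = (\<integral>\<^sup>+\<theta>. top * indicator {0..pi/2} \<theta> \<partial>lebesgue)"
      by (intro nn_integral_cong) (auto simp: indicator_def)
    also have "\<dots> = top"
      by (subst nn_integral_cmult_indicator) (auto simp: ennreal_top_mult)
    finally show False using fin by (simp add: q_def)
  qed
  ultimately obtain m where m: "M = ereal m" by (cases M) auto
  show thesis
  proof (rule that[of m])
    have "AE s in lebesgue. s \<notin> S R (m - 1 / real (Suc k))" for k
      by (intro AE_not_in null) (simp add: m)
    then have "AE s in lebesgue. \<forall>k. s \<notin> S R (m - 1 / real (Suc k))"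
      by (simp add: AE_all_countable)
    then have "AE s in lborel. \<forall>k. s \<notin> S R (m - 1 / real (Suc k))"
      by (simp add: AE_completion_iff)
    then show "AE s in lborel. R \<le> s \<longrightarrow> L * s + m \<le> Q s"
    proof eventually_elim
      case (elim s)
      show ?case
      proof
        assume "R \<le> s"
        then have lt: "m - 1 / real (Suc k) < q s" for k
            using elim[rule_format, of k] by (simp add: S_def)
        have "m \<le> q s"
        proof (rule ccontr)
          assume "\<not> m \<le> q s"
          then obtain k where "1 / real (Suc k) < m - q s"
            using nat_approx_posE[of "m - q s"] by auto
          with lt[of k] show False by simp
        qed
        then show "L * s + m \<le> Q s" by (simp add: q_def shift_lin_def)
      qed
    qed
    fix \<theta> :: real assume \<theta>: "0 \<le> \<theta>" "\<theta> \<le> pi/2"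
    have "0 \<le> R * cos \<theta>" "R * cos \<theta> \<le> R"
      using \<theta> R by (auto intro!: mult_nonneg_nonneg cos_ge_zero)
    then have "ess_inf_tail q (R * cos \<theta>) \<le> ereal m" using mono m by simp
    then have "ereal (q (R * cos \<theta>)) - ereal m \<le> oscillation_part q (R * cos \<theta>)"
      unfolding oscillation_part_def by (intro ereal_minus_mono) auto
    then have "e2ennreal (ereal (q (R * cos \<theta>) - m)) \<le> e2ennreal (oscillation_part q (R * cos \<theta>))"
      by (intro e2ennreal_mono) simp
    then show "ennreal (Q (R * cos \<theta>) - L * (R * cos \<theta>) - m)
      \<le> e2ennreal (oscillation_part (shift_lin L Q) (R * cos \<theta>))"
      by (simp add: q_def shift_lin_def e2ennreal_ereal)
  qed
qed

lemma borel_version_on_halfline: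
  fixes Q :: "real \<Rightarrow> real"
  assumes Q: "Q \<in> borel_measurable (lebesgue_on {0..})"
  obtains Q' where "Q' \<in> borel_measurable borel" "AE t in lborel. 0 \<le> t \<longrightarrow> Q t = Q' t"
proof -
  have "(\<lambda>t. if t \<in> {0..} then Q t else 0) \<in> borel_measurable lebesgue"
    using Q by (subst borel_measurable_if) auto
  from completion_ex_borel_measurable_real[OF this]
  obtain Q' where "Q' \<in> borel_measurable lborel" "AE t in lborel. (if t \<in> {0..} then Q t else 0) = Q' t"
    by blast
  then show thesis by (intro that[of Q']) (auto elim: eventually_mono)
qed

text \<open>The substitution \<open>s = R * cos \<theta>\<close> applied to the indicator of a null set; its Jacobian vanishes only at
  \<open>\<theta> = 0\<close>.\<close>

lemma AE_quarter_cos: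
  assumes P: "AE t in lborel. P t" and R: "0 < R"
  shows "AE \<theta> in quarter. P (R * cos \<theta>)"
proof -
  obtain N where N: "{t. \<not> P t} \<subseteq> N" "emeasure lborel N = 0" "N \<in> sets lborel"
    using AE_E[OF P] by auto
  have [measurable]: "N \<in> sets borel" using N(3) by simp
  have "(\<integral>\<^sup>+\<theta>. indicator N (R * cos \<theta>) * ennreal (R * sin \<theta>) \<partial>quarter)
      = (\<integral>\<^sup>+s\<in>{0..R}. indicator N s \<partial>lborel)"
    using R by (intro nn_integral_cos_substitution) auto
  also have "\<dots> \<le> (\<integral>\<^sup>+s. indicator N s \<partial>lborel)"
    by (intro nn_integral_mono) (auto simp: indicator_def)
  also have "\<dots> = 0" using N by simp
  finally have "(\<integral>\<^sup>+\<theta>. indicator N (R * cos \<theta>) * ennreal (R * sin \<theta>) \<partial>quarter) = 0" by simp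
  then have "AE \<theta> in quarter. indicator N (R * cos \<theta>) * ennreal (R * sin \<theta>) = 0"
    by (subst (asm) nn_integral_0_iff_AE) (intro measurable_restrict_space1, measurable)
  moreover have "AE \<theta> in lborel. \<theta> \<noteq> (0::real)" by (rule AE_lborel_singleton)
  ultimately show ?thesis unfolding AE_quarter
  proof eventually_elim
    case (elim \<theta>)
    show ?case
    proof
      assume \<theta>: "0 \<le> \<theta> \<and> \<theta> \<le> pi/2"
      then have "0 < sin \<theta>" using elim(2) pi_gt_zero by (intro sin_gt_zero) auto
      then have "R * cos \<theta> \<notin> N" using elim(1) \<theta> R by (auto simp: indicator_def mult_le_0_iff split: if_splits)
      then show "P (R * cos \<theta>)" using N(1) by auto
    qed
  qed
qed

lemma eventually_minorant:
  fixes Q Q' :: "real \<Rightarrow> real"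
  assumes Q: "Q \<in> borel_measurable (lebesgue_on {0..})" and Q': "AE t in lborel. 0 \<le> t \<longrightarrow> Q t = Q' t"
    and osc: "\<forall>\<^sub>F t in at_top.
      (\<integral>\<^sup>+\<theta>\<in>{0..pi/2}. e2ennreal (oscillation_part (shift_lin L Q) (t * cos \<theta>)) \<partial>lebesgue)
        < ennreal (B + ln t)"
  shows "\<forall>\<^sub>F R in at_top. \<exists>m. (AE s in lborel. R \<le> s \<longrightarrow> L * s + m \<le> Q' s) \<and>
      (\<integral>\<^sup>+\<theta>. ennreal (Q' (R * cos \<theta>) - L * (R * cos \<theta>) - m) \<partial>quarter) \<le> ennreal (B + ln R)"
  using osc eventually_gt_at_top[of 0]
proof eventually_elim
  case (elim R)
  let ?osc = "\<lambda>\<theta>. e2ennreal (oscillation_part (shift_lin L Q) (R * cos \<theta>))"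
  obtain m where m: "AE s in lborel. R \<le> s \<longrightarrow> L * s + m \<le> Q s"
    "\<And>\<theta>. 0 \<le> \<theta> \<Longrightarrow> \<theta> \<le> pi/2 \<Longrightarrow> ennreal (Q (R * cos \<theta>) - L * (R * cos \<theta>) - m) \<le> ?osc \<theta>"
    using ess_inf_tail_minorant[OF Q elim(2) less_trans[OF elim(1) ennreal_less_top]] by blast
  have "AE \<theta> in quarter. 0 \<le> R * cos \<theta> \<longrightarrow> Q (R * cos \<theta>) = Q' (R * cos \<theta>)"
    by (rule AE_quarter_cos[OF Q' elim(2)])
  then have "AE \<theta> in quarter. ennreal (Q' (R * cos \<theta>) - L * (R * cos \<theta>) - m) \<le> ?osc \<theta>"
    unfolding AE_quarter
  proof eventually_elim
    case (elim \<theta>)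
    then show ?case using m(2)[of \<theta>] \<open>0 < R\<close> cos_ge_zero[of \<theta>] by auto
  qed
  then have "(\<integral>\<^sup>+\<theta>. ennreal (Q' (R * cos \<theta>) - L * (R * cos \<theta>) - m) \<partial>quarter) \<le> (\<integral>\<^sup>+\<theta>. ?osc \<theta> \<partial>quarter)"
    by (rule nn_integral_mono_AE)
  also have "\<dots> \<le> ennreal (B + ln R)"
    using elim(1) by (simp add: nn_integral_quarter nn_integral_completion less_imp_le)
  finally have "(\<integral>\<^sup>+\<theta>. ennreal (Q' (R * cos \<theta>) - L * (R * cos \<theta>) - m) \<partial>quarter) \<le> ennreal (B + ln R)" .
  moreover have "AE s in lborel. R \<le> s \<longrightarrow> L * s + m \<le> Q' s"
    using m(1) Q' by eventually_elim (use \<open>0 < R\<close> in auto)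
  ultimately show ?case by blast
qed

section \<open>Integration along coordinate lines\<close>

text \<open>Fubini's theorem for one coordinate direction, in a form that avoids splitting the space into a product.\<close>

lemma nn_integral_le_by_coordinate:
  fixes F G :: "'a :: euclidean_space \<Rightarrow> ennreal"
  assumes [measurable]: "F \<in> borel_measurable borel" "G \<in> borel_measurable borel" and b: "b \<in> Basis"
    and le: "\<And>x. x \<bullet> b = 0 \<Longrightarrow>
      (\<integral>\<^sup>+t. F (x + t *\<^sub>R b) \<partial>lborel) \<le> A * (\<integral>\<^sup>+t. G (x + t *\<^sub>R b) \<partial>lborel)"
  shows "(\<integral>\<^sup>+x. F x \<partial>lborel) \<le> A * (\<integral>\<^sup>+x. G x \<partial>lborel)"
proof -
  interpret product_sigma_finite "\<lambda>_::'a. lborel :: real measure"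
    by standard
  let ?I = "Basis - {b}"
  let ?x = "\<lambda>f. \<Sum>c\<in>?I. f c *\<^sub>R c"
  have split: "(\<integral>\<^sup>+x. H x \<partial>lborel) =
      (\<integral>\<^sup>+f. (\<integral>\<^sup>+t. H (?x f + t *\<^sub>R b) \<partial>lborel) \<partial>Pi\<^sub>M ?I (\<lambda>_. lborel))"
    if [measurable]: "H \<in> borel_measurable borel" for H :: "'a \<Rightarrow> ennreal"
  proof -
    have ins: "insert b ?I = Basis" using b by auto
    have "(\<integral>\<^sup>+x. H x \<partial>lborel) = (\<integral>\<^sup>+f. H (\<Sum>c\<in>Basis. f c *\<^sub>R c) \<partial>Pi\<^sub>M Basis (\<lambda>_. lborel))"
      by (subst lborel_eq) (rule nn_integral_distr, measurable)
    also have "\<dots> = (\<integral>\<^sup>+f. H (\<Sum>c\<in>Basis. f c *\<^sub>R c) \<partial>Pi\<^sub>M (insert b ?I) (\<lambda>_. lborel))"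
      by (simp only: ins)
    also have "\<dots> = (\<integral>\<^sup>+f. (\<integral>\<^sup>+t. H (\<Sum>c\<in>Basis. (f(b := t)) c *\<^sub>R c) \<partial>lborel) \<partial>Pi\<^sub>M ?I (\<lambda>_. lborel))"
      by (rule product_nn_integral_insert) (auto simp only: ins, measurable)
    also have "\<dots> = (\<integral>\<^sup>+f. (\<integral>\<^sup>+t. H (?x f + t *\<^sub>R b) \<partial>lborel) \<partial>Pi\<^sub>M ?I (\<lambda>_. lborel))"
    proof -
      have "(\<Sum>c\<in>Basis. (f(b := t)) c *\<^sub>R c) = ?x f + t *\<^sub>R b" for f t
        using b by (subst sum.remove[of _ b]) (auto simp: add.commute intro!: sum.cong)
      then show ?thesis by simp
    qed
    finally show ?thesis .
  qed
  have "(\<integral>\<^sup>+x. F x \<partial>lborel) \<le> (\<integral>\<^sup>+x. A * G x \<partial>lborel)"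
  proof (subst (1 2) split, measurable, rule nn_integral_mono)
    fix f
    have "?x f \<bullet> b = (\<Sum>c\<in>?I. f c * (c \<bullet> b))" by (simp add: inner_sum_left)
    also have "\<dots> = 0" using b by (intro sum.neutral) (auto simp: inner_Basis)
    finally have "(\<integral>\<^sup>+t. F (?x f + t *\<^sub>R b) \<partial>lborel) \<le> A * (\<integral>\<^sup>+t. G (?x f + t *\<^sub>R b) \<partial>lborel)"
      by (rule le)
    also have "\<dots> = (\<integral>\<^sup>+t. A * G (?x f + t *\<^sub>R b) \<partial>lborel)"
      by (rule nn_integral_cmult[symmetric]) measurable
    finally show "(\<integral>\<^sup>+t. F (?x f + t *\<^sub>R b) \<partial>lborel) \<le> (\<integral>\<^sup>+t. A * G (?x f + t *\<^sub>R b) \<partial>lborel)" .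
  qed
  also have "\<dots> = A * (\<integral>\<^sup>+x. G x \<partial>lborel)" by (rule nn_integral_cmult) measurable
  finally show ?thesis .
qed

lemma AE_lborel_coordinate:
  fixes i :: "'d::finite"
  assumes P: "AE t in lborel. P t"
  shows "AE \<xi> in (lborel :: (real^'d) measure). P (\<xi> $ i)"
proof -
  obtain N where N: "{t. \<not> P t} \<subseteq> N" "emeasure lborel N = 0" "N \<in> sets lborel"
    using AE_E[OF P] by auto
  have [measurable]: "N \<in> sets borel" using N(3) by simp
  have [measurable]: "(\<lambda>\<xi>::real^'d. \<xi> $ i) \<in> borel_measurable borel"
    by (intro borel_measurable_continuous_onI continuous_intros)
  have "(\<integral>\<^sup>+\<xi>. indicator N ((\<xi> :: real^'d) $ i) \<partial>lborel) \<le> 0 * (\<integral>\<^sup>+\<xi>. 0 \<partial>(lborel :: (real^'d) measure))"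
  proof (rule nn_integral_le_by_coordinate[of _ _ "axis i 1"])
    fix x :: "real^'d" assume "x \<bullet> axis i 1 = 0"
    then have "x $ i = 0" by (simp add: inner_axis)
    then have "(\<integral>\<^sup>+t. indicator N ((x + t *\<^sub>R axis i 1) $ i) \<partial>lborel) = (\<integral>\<^sup>+t. indicator N t \<partial>lborel)"
      by (simp add: axis_def)
    then show "(\<integral>\<^sup>+t. indicator N ((x + t *\<^sub>R axis i 1) $ i) \<partial>lborel)
        \<le> 0 * (\<integral>\<^sup>+t. 0 \<partial>(lborel :: real measure))" using N by simp
  qed (auto simp: axis_in_Basis_iff)
  then have "(\<integral>\<^sup>+\<xi>. indicator N ((\<xi> :: real^'d) $ i) \<partial>lborel) = 0" by simp
  then have "AE \<xi> in (lborel :: (real^'d) measure). indicator N (\<xi> $ i) = (0::ennreal)"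
    by (subst (asm) nn_integral_0_iff_AE) auto
  then show ?thesis using N(1) by (auto elim!: eventually_mono simp: indicator_def split: if_splits)
qed

lemma poly_funs_measurable:
  assumes "P \<in> poly_funs n"
  shows "P \<in> borel_measurable (borel :: (real^'d) measure)"
proof -
  obtain c where P: "P = (\<lambda>\<xi>::real^'d. \<Sum>\<alpha> | (\<Sum>i\<in>UNIV. \<alpha> i) \<le> n. c \<alpha> * (\<Prod>i\<in>UNIV. complex_of_real (\<xi> $ i) ^ \<alpha> i))"
    using assms unfolding poly_funs_def by blast
  show ?thesis unfolding P
    by (intro borel_measurable_continuous_onI continuous_intros)
qed

lemma poly_funs_section:
  fixes x :: "real^'d"
  assumes P: "P \<in> poly_funs n" and x: "x $ i = 0"
  obtains p :: "complex poly" where "degree p \<le> n"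
    "\<And>t. P (x + t *\<^sub>R axis i 1) = poly p (of_real t)"
proof -
  obtain c where P: "P = (\<lambda>\<xi>::real^'d. \<Sum>\<alpha> | (\<Sum>i\<in>UNIV. \<alpha> i) \<le> n. c \<alpha> * (\<Prod>i\<in>UNIV. complex_of_real (\<xi> $ i) ^ \<alpha> i))"
    using assms unfolding poly_funs_def by blast
  define p where "p = (\<Sum>\<alpha> | (\<Sum>j\<in>UNIV. \<alpha> j) \<le> n.
    monom (c \<alpha> * (\<Prod>j\<in>UNIV - {i}. complex_of_real (x $ j) ^ \<alpha> j)) (\<alpha> i))"
  show thesis
  proof (rule that[of p])
    show "degree p \<le> n" unfolding p_def
    proof (rule degree_sum_le[OF finite_multi_indices])
      fix \<alpha> :: "'d \<Rightarrow> nat" assume "\<alpha> \<in> {\<alpha>. (\<Sum>j\<in>UNIV. \<alpha> j) \<le> n}"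
      then have "\<alpha> i \<le> n" using member_le_sum[of i UNIV \<alpha>] by simp
      then show "degree (monom (c \<alpha> * (\<Prod>j\<in>UNIV - {i}. complex_of_real (x $ j) ^ \<alpha> j)) (\<alpha> i)) \<le> n"
        using degree_monom_le order_trans by blast
    qed
    fix t
    have "(\<Prod>j\<in>UNIV. complex_of_real ((x + t *\<^sub>R axis i 1) $ j) ^ \<alpha> j)
        = of_real t ^ \<alpha> i * (\<Prod>j\<in>UNIV - {i}. complex_of_real (x $ j) ^ \<alpha> j)" for \<alpha> :: "'d \<Rightarrow> nat"
    proof -
      have "(\<Prod>j\<in>UNIV - {i}. complex_of_real ((x + t *\<^sub>R axis i 1) $ j) ^ \<alpha> j)
          = (\<Prod>j\<in>UNIV - {i}. complex_of_real (x $ j) ^ \<alpha> j)"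
        by (intro prod.cong) (auto simp: axis_def)
      then show ?thesis using x by (subst prod.remove[of _ i]) (auto simp: axis_def)
    qed
    then show "P (x + t *\<^sub>R axis i 1) = poly p (of_real t)"
      by (simp add: P p_def poly_sum poly_monom mult_ac)
  qed
qed

section \<open>Exponential factors in several variables\<close>

text \<open>The coordinates are switched one at a time from \<open>exp (- (2 * Y * \<bar>t\<bar>))\<close> to \<open>exp (2 * Y * \<bar>t\<bar>)\<close>. On a line
  in a coordinate direction, the integrand is a constant times a weighted polynomial in one variable, even when
  other coordinates carry exponential factors.\<close>

lemma weighted_poly_comparison:
  fixes Q :: "'d::finite \<Rightarrow> real \<Rightarrow> real"
  assumes Q[measurable]: "\<And>i. Q i \<in> borel_measurable borel"
    and one: "\<And>i. \<exists>C\<ge>0. \<forall>\<^sub>F n in sequentially. \<forall>p. degree p \<le> n \<longrightarrow>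
      (\<integral>\<^sup>+x. ennreal ((cmod (poly p (of_real x)))\<^sup>2 * exp (2 * Y * \<bar>x\<bar> - Q i \<bar>x\<bar>)) \<partial>lborel) \<le>
      ennreal (C * K ^ n) *
      (\<integral>\<^sup>+x. ennreal ((cmod (poly p (of_real x)))\<^sup>2 * exp (- (2 * Y * \<bar>x\<bar>) - Q i \<bar>x\<bar>)) \<partial>lborel)"
    and K: "0 \<le> K"
  shows "\<exists>C\<ge>0. \<forall>\<^sub>F n in sequentially. \<forall>P\<in>poly_funs n.
    (\<integral>\<^sup>+\<xi>. ennreal ((cmod (P \<xi>))\<^sup>2 * (\<Prod>i\<in>UNIV. exp (2 * Y * \<bar>\<xi> $ i\<bar> - Q i \<bar>\<xi> $ i\<bar>))) \<partial>lborel)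
    \<le> ennreal (C * K ^ n) ^ CARD('d) *
      (\<integral>\<^sup>+\<xi>. ennreal ((cmod (P \<xi>))\<^sup>2 * (\<Prod>i\<in>UNIV. exp (- (2 * Y * \<bar>\<xi> $ i\<bar>) - Q i \<bar>\<xi> $ i\<bar>))) \<partial>lborel)"
proof -
  define T where "T = (\<lambda>i n M. \<forall>p. degree p \<le> n \<longrightarrow>
      (\<integral>\<^sup>+x. ennreal ((cmod (poly p (of_real x)))\<^sup>2 * exp (2 * Y * \<bar>x\<bar> - Q i \<bar>x\<bar>)) \<partial>lborel) \<le>
      ennreal M *
      (\<integral>\<^sup>+x. ennreal ((cmod (poly p (of_real x)))\<^sup>2 * exp (- (2 * Y * \<bar>x\<bar>) - Q i \<bar>x\<bar>)) \<partial>lborel))"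
  have "\<forall>i. \<exists>C. 0 \<le> C \<and> (\<forall>\<^sub>F n in sequentially. T i n (C * K ^ n))"
    using one unfolding T_def by (rule allI)
  from choice[OF this] obtain c
    where c: "\<forall>i. 0 \<le> c i \<and> (\<forall>\<^sub>F n in sequentially. T i n (c i * K ^ n))" ..
  define C where "C = (\<Sum>i\<in>UNIV. c i)"
  have cC: "c i \<le> C" for i unfolding C_def using c by (intro member_le_sum) auto
  have C0: "0 \<le> C" unfolding C_def using c by (intro sum_nonneg) auto
  have "\<forall>\<^sub>F n in sequentially. \<forall>i. T i n (c i * K ^ n)"
    using c by (intro eventually_all_finite) blast
  then have "\<forall>\<^sub>F n in sequentially. \<forall>P\<in>poly_funs n.
    (\<integral>\<^sup>+\<xi>. ennreal ((cmod (P \<xi>))\<^sup>2 * (\<Prod>i\<in>UNIV. exp (2 * Y * \<bar>\<xi> $ i\<bar> - Q i \<bar>\<xi> $ i\<bar>))) \<partial>lborel)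
    \<le> ennreal (C * K ^ n) ^ CARD('d) *
      (\<integral>\<^sup>+\<xi>. ennreal ((cmod (P \<xi>))\<^sup>2 * (\<Prod>i\<in>UNIV. exp (- (2 * Y * \<bar>\<xi> $ i\<bar>) - Q i \<bar>\<xi> $ i\<bar>))) \<partial>lborel)"
  proof (eventually_elim, intro ballI)
    fix n and P :: "real^'d \<Rightarrow> complex"
    assume bound: "\<forall>i. T i n (c i * K ^ n)"
      and P: "P \<in> poly_funs n"
    have [measurable]: "P \<in> borel_measurable borel" by (rule poly_funs_measurable[OF P])
    have [measurable]: "(\<lambda>\<xi>::real^'d. \<xi> $ i) \<in> borel_measurable borel" for i
      by (intro borel_measurable_continuous_onI continuous_intros)
    \<comment> \<open>\<open>s\<close> gives the sign in front of \<open>2 * Y * \<bar>t\<bar>\<close> for each coordinate; the coordinates in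
      \<open>S\<close> have already been switched.\<close>
    define s where "s = (\<lambda>S (i::'d) t. exp ((if i \<in> S then 2 * Y * \<bar>t\<bar> else - (2 * Y * \<bar>t\<bar>)) - Q i \<bar>t\<bar>))"
    define E where "E = (\<lambda>S (\<xi>::real^'d). ennreal ((cmod (P \<xi>))\<^sup>2 * (\<Prod>i\<in>UNIV. s S i (\<xi> $ i))))"
    have [measurable]: "s S i \<in> borel_measurable borel" for S i unfolding s_def by measurable
    have [measurable]: "E S \<in> borel_measurable borel" for S unfolding E_def by measurable
    have "(\<integral>\<^sup>+\<xi>. E S \<xi> \<partial>lborel) \<le> ennreal (C * K ^ n) ^ card S * (\<integral>\<^sup>+\<xi>. E {} \<xi> \<partial>lborel)" for S
    proof (induction S rule: finite_induct[OF finite])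
      case 1
      then show ?case by simp
    next
      case (2 i S)
      have "(\<integral>\<^sup>+\<xi>. E (insert i S) \<xi> \<partial>lborel) \<le> ennreal (C * K ^ n) * (\<integral>\<^sup>+\<xi>. E S \<xi> \<partial>lborel)"
      proof (rule nn_integral_le_by_coordinate[of _ _ "axis i 1"])
        fix x :: "real^'d" assume "x \<bullet> axis i 1 = 0"
        then have x: "x $ i = 0" by (simp add: inner_axis)
        obtain p where p: "degree p \<le> n" "\<And>t. P (x + t *\<^sub>R axis i 1) = poly p (of_real t)"
          using poly_funs_section[OF P x] by blast
        have [measurable]: "(\<lambda>t. poly p (complex_of_real t)) \<in> borel_measurable borel"
          by (intro borel_measurable_continuous_onI continuous_intros)
        define A where "A = (\<Prod>j\<in>UNIV - {i}. s S j (x $ j))"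
        have A: "0 \<le> A" unfolding A_def s_def by (intro prod_nonneg) auto
        have E: "E T (x + t *\<^sub>R axis i 1) = ennreal A * ennreal ((cmod (poly p (of_real t)))\<^sup>2 * s T i t)"
          if T: "T = S \<or> T = insert i S" for T t
        proof -
          have "(\<Prod>j\<in>UNIV - {i}. s T j ((x + t *\<^sub>R axis i 1) $ j)) = A"
            unfolding A_def using T by (intro prod.cong) (auto simp: s_def axis_def)
          then have "(\<Prod>j\<in>UNIV. s T j ((x + t *\<^sub>R axis i 1) $ j)) = s T i t * A"
            using x by (subst prod.remove[of _ i]) (auto simp: axis_def)
          then show ?thesis using A by (simp add: E_def p(2) ennreal_mult'[symmetric] mult_ac)
        qed
        have "(\<integral>\<^sup>+t. ennreal ((cmod (poly p (of_real t)))\<^sup>2 * s (insert i S) i t) \<partial>lborel)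
            \<le> ennreal (c i * K ^ n) * (\<integral>\<^sup>+t. ennreal ((cmod (poly p (of_real t)))\<^sup>2 * s S i t) \<partial>lborel)"
          using bound p(1) 2(2) by (simp add: s_def T_def)
        also have "\<dots> \<le> ennreal (C * K ^ n) * (\<integral>\<^sup>+t. ennreal ((cmod (poly p (of_real t)))\<^sup>2 * s S i t) \<partial>lborel)"
          using cC K by (intro mult_right_mono ennreal_leI) auto
        finally have "ennreal A * (\<integral>\<^sup>+t. ennreal ((cmod (poly p (of_real t)))\<^sup>2 * s (insert i S) i t) \<partial>lborel)
            \<le> ennreal A * (ennreal (C * K ^ n) * (\<integral>\<^sup>+t. ennreal ((cmod (poly p (of_real t)))\<^sup>2 * s S i t) \<partial>lborel))"
          by (intro mult_left_mono) auto
        then show "(\<integral>\<^sup>+t. E (insert i S) (x + t *\<^sub>R axis i 1) \<partial>lborel)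
            \<le> ennreal (C * K ^ n) * (\<integral>\<^sup>+t. E S (x + t *\<^sub>R axis i 1) \<partial>lborel)"
          by (simp add: E nn_integral_cmult mult.left_commute)
      qed (auto simp: axis_in_Basis_iff)
      also have "\<dots> \<le> ennreal (C * K ^ n) * (ennreal (C * K ^ n) ^ card S * (\<integral>\<^sup>+\<xi>. E {} \<xi> \<partial>lborel))"
        by (intro mult_left_mono 2) auto
      finally show ?case using 2 by (simp add: mult_ac)
    qed
    from this[of UNIV]
    show "(\<integral>\<^sup>+\<xi>. ennreal ((cmod (P \<xi>))\<^sup>2 * (\<Prod>i\<in>UNIV. exp (2 * Y * \<bar>\<xi> $ i\<bar> - Q i \<bar>\<xi> $ i\<bar>))) \<partial>lborel)
    \<le> ennreal (C * K ^ n) ^ CARD('d) *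
      (\<integral>\<^sup>+\<xi>. ennreal ((cmod (P \<xi>))\<^sup>2 * (\<Prod>i\<in>UNIV. exp (- (2 * Y * \<bar>\<xi> $ i\<bar>) - Q i \<bar>\<xi> $ i\<bar>))) \<partial>lborel)"
      by (simp add: E_def s_def)
  qed
  with C0 show ?thesis by blast
qed

lemma enn_root_ratio_le:
  assumes "a \<le> ennreal D * b" "0 \<le> D"
  shows "enn_root 2 a / enn_root 2 b \<le> ennreal (sqrt D)"
proof (cases "b = top")
  case True
  then show ?thesis by (simp add: enn_root_def)
next
  case False
  then obtain \<beta> where \<beta>: "b = ennreal \<beta>" "0 \<le> \<beta>" by (cases b) auto
  with assms(1) have "a \<noteq> top" by (auto simp: ennreal_mult_eq_top_iff top_unique)
  then obtain \<alpha> where \<alpha>: "a = ennreal \<alpha>" "0 \<le> \<alpha>" by (cases a) auto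
  have le: "\<alpha> \<le> D * \<beta>" using assms \<alpha> \<beta> by (simp add: ennreal_mult[symmetric])
  show ?thesis
  proof (cases "\<beta> = 0")
    case True
    with le \<alpha> have "\<alpha> = 0" by simp
    then show ?thesis using \<alpha> by (simp add: enn_root_def)
  next
    case False
    have "sqrt \<alpha> / sqrt \<beta> \<le> sqrt D"
      using le False \<beta> by (simp add: real_sqrt_divide[symmetric] pos_divide_le_eq)
    then show ?thesis using \<alpha> \<beta> False
      by (simp add: enn_root_def sqrt_def[symmetric] divide_ennreal ennreal_leI)
  qed
qed

lemma enn_root_power_bound:
  assumes "x \<le> ennreal (b ^ n)" "0 \<le> b" "0 < n"
  shows "enn_root n x \<le> ennreal b"
proof -
  have "x \<noteq> top" using assms(1) by (auto simp: top_unique)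
  then obtain r where r: "x = ennreal r" "0 \<le> r" by (cases x) auto
  with assms have "r \<le> b ^ n" by simp
  then have "root n r \<le> root n (b ^ n)" using assms(3) by simp
  also have "\<dots> = b" using assms by (simp add: real_root_power_cancel)
  finally show ?thesis using r by (simp add: enn_root_def ennreal_leI)
qed

text \<open>Since \<open>\<bar>y \<bullet> \<xi>\<bar> \<le> (\<Sum>i. Y * \<bar>\<xi> $ i\<bar>)\<close>, the integrands of both norms in either of the two quotients lie between
  the same two product integrands.\<close>

lemma exp_mult_sandwich:
  fixes y \<xi> :: "real^'d" and q :: "'d \<Rightarrow> real"
  assumes "norm y \<le> Y"
  shows "(cmod (P \<xi>))\<^sup>2 * (\<Prod>i\<in>UNIV. exp (- (2 * Y * \<bar>\<xi> $ i\<bar>) - q i))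
      \<le> (cmod (exp_mult y P \<xi>))\<^sup>2 * (\<Prod>i\<in>UNIV. exp (- q i))"
    and "(cmod (exp_mult y P \<xi>))\<^sup>2 * (\<Prod>i\<in>UNIV. exp (- q i))
      \<le> (cmod (P \<xi>))\<^sup>2 * (\<Prod>i\<in>UNIV. exp (2 * Y * \<bar>\<xi> $ i\<bar> - q i))"
proof -
  have "\<bar>y \<bullet> \<xi>\<bar> \<le> (\<Sum>i\<in>UNIV. \<bar>y $ i * \<xi> $ i\<bar>)"
    unfolding inner_vec_def by (simp add: sum_abs)
  also have "\<dots> \<le> (\<Sum>i\<in>UNIV. Y * \<bar>\<xi> $ i\<bar>)"
    using order_trans[OF component_le_norm_cart assms]
    by (intro sum_mono) (simp add: abs_mult mult_right_mono)
  finally have le: "\<bar>y \<bullet> \<xi>\<bar> \<le> (\<Sum>i\<in>UNIV. Y * \<bar>\<xi> $ i\<bar>)" .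
  have sq: "(cmod (exp_mult y P \<xi>))\<^sup>2 * (\<Prod>i\<in>UNIV. exp (- q i))
      = (cmod (P \<xi>))\<^sup>2 * exp (2 * (y \<bullet> \<xi>) - (\<Sum>i\<in>UNIV. q i))"
  proof -
    have "(\<Prod>i\<in>UNIV. exp (- q i)) = exp (- (\<Sum>i\<in>UNIV. q i))"
      by (simp only: exp_sum[symmetric] sum_negf finite)
    moreover have "(cmod (exp_mult y P \<xi>))\<^sup>2 = (cmod (P \<xi>))\<^sup>2 * exp (2 * (y \<bullet> \<xi>))"
      by (simp add: exp_mult_def norm_mult power_mult_distrib exp_double[symmetric])
    ultimately show ?thesis by (simp add: exp_diff exp_minus divide_inverse)
  qed
  have p1: "(\<Prod>i\<in>UNIV. exp (- (2 * Y * \<bar>\<xi> $ i\<bar>) - q i))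
      = exp (- 2 * (\<Sum>i\<in>UNIV. Y * \<bar>\<xi> $ i\<bar>) - (\<Sum>i\<in>UNIV. q i))"
    by (simp add: exp_sum[symmetric] sum_subtractf sum_negf sum_distrib_left mult.assoc)
  have p2: "(\<Prod>i\<in>UNIV. exp (2 * Y * \<bar>\<xi> $ i\<bar> - q i))
      = exp (2 * (\<Sum>i\<in>UNIV. Y * \<bar>\<xi> $ i\<bar>) - (\<Sum>i\<in>UNIV. q i))"
    by (simp add: exp_sum[symmetric] sum_subtractf sum_distrib_left mult.assoc)
  show "(cmod (P \<xi>))\<^sup>2 * (\<Prod>i\<in>UNIV. exp (- (2 * Y * \<bar>\<xi> $ i\<bar>) - q i))
      \<le> (cmod (exp_mult y P \<xi>))\<^sup>2 * (\<Prod>i\<in>UNIV. exp (- q i))"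
    unfolding sq p1 using le by (intro mult_left_mono) auto
  show "(cmod (exp_mult y P \<xi>))\<^sup>2 * (\<Prod>i\<in>UNIV. exp (- q i))
      \<le> (cmod (P \<xi>))\<^sup>2 * (\<Prod>i\<in>UNIV. exp (2 * Y * \<bar>\<xi> $ i\<bar> - q i))"
    unfolding sq p2 using le by (intro mult_left_mono) auto
qed

section \<open>Quasi-symmetries of product weights\<close>

text \<open>The entry in column \<open>j\<close> is placed in row \<open>\<pi> j\<close> because the quasi-symmetries act through their
  transposes.\<close>

definition signed_perm_matrix :: "('d \<Rightarrow> 'd) \<Rightarrow> ('d \<Rightarrow> real) \<Rightarrow> real^'d^'d" where
  "signed_perm_matrix \<pi> s = (\<chi> k j. if k = \<pi> j then s j else 0)"

lemma transpose_signed_perm_matrix_mult: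
  fixes \<xi> :: "real^'d" and \<pi> :: "'d \<Rightarrow> 'd"
  shows "(transpose (signed_perm_matrix \<pi> s) *v \<xi>) $ j = s j * \<xi> $ \<pi> j"
proof -
  have "(transpose (signed_perm_matrix \<pi> s) *v \<xi>) $ j
      = (\<Sum>k\<in>UNIV. if k = \<pi> j then s j * \<xi> $ k else 0)"
    by (simp add: transpose_def signed_perm_matrix_def matrix_vector_mult_def if_distrib
        if_distribR cong: if_cong)
  then show ?thesis by simp
qed

lemma invertible_signed_perm_matrix:
  fixes \<pi> :: "'d::finite \<Rightarrow> 'd"
  assumes "surj \<pi>" and s: "\<And>j. s j \<noteq> 0"
  shows "invertible (signed_perm_matrix \<pi> s)"
proof -
  have "inj ((*v) (transpose (signed_perm_matrix \<pi> s)))"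
  proof (rule injI)
    fix \<xi> \<eta> :: "real^'d"
    assume eq: "transpose (signed_perm_matrix \<pi> s) *v \<xi> = transpose (signed_perm_matrix \<pi> s) *v \<eta>"
    have "\<xi> $ \<pi> j = \<eta> $ \<pi> j" for j
      using arg_cong[OF eq, of "\<lambda>v. v $ j"] s[of j]
      unfolding transpose_signed_perm_matrix_mult by simp
    with assms(1) show "\<xi> = \<eta>" by (metis vec_eq_iff surj_def)
  qed
  then have "invertible (transpose (signed_perm_matrix \<pi> s))"
    using invertible_left_inverse matrix_left_invertible_injective by blast
  then show ?thesis using transpose_invertible transpose_transpose by metis
qed

lemma AE_lebesgue_matrix_preimage:
  fixes M :: "real^'d^'d"
  assumes P: "AE \<xi> in lebesgue. P \<xi>" and M: "invertible M"
  shows "AE \<xi> in lebesgue. P (M *v \<xi>)"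
proof -
  obtain M' where M': "M' ** M = mat 1" using M unfolding invertible_def by blast
  obtain N where "negligible N" "{\<xi>. \<not> P \<xi>} \<subseteq> N"
    using P unfolding eventually_ae_filter_negligible by blast
  then have "negligible {\<xi>. \<not> P \<xi>}" by (rule negligible_subset)
  then have "negligible ((*v) M' ` {\<xi>. \<not> P \<xi>})"
    by (intro negligible_differentiable_image_negligible linear_imp_differentiable_on
        matrix_vector_mul_linear) simp_all
  moreover have "{\<xi>. \<not> P (M *v \<xi>)} \<subseteq> (*v) M' ` {\<xi>. \<not> P \<xi>}"
  proof
    fix \<xi> assume "\<xi> \<in> {\<xi>. \<not> P (M *v \<xi>)}"
    moreover have "\<xi> = M' *v (M *v \<xi>)" by (simp add: matrix_vector_mul_assoc M')
    ultimately show "\<xi> \<in> (*v) M' ` {\<xi>. \<not> P \<xi>}" by blast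
  qed
  ultimately show ?thesis
    unfolding eventually_ae_filter_negligible by blast
qed

text \<open>Signs do not change \<open>\<bar>\<xi> $ i\<bar>\<close>, and a permutation of the coordinates changes each exponent by at most one of the
  bounds for \<open>Q i - Q j\<close>.\<close>

lemma signed_perm_matrix_quasi_sym:
  fixes w :: "real^'d \<Rightarrow> real" and Q :: "'d \<Rightarrow> real \<Rightarrow> real"
  assumes w_prod: "AE \<xi> in lebesgue. w \<xi> = (\<Prod>i\<in>UNIV. exp (- Q i \<bar>\<xi> $ i\<bar>))"
    and Q_diff: "\<And>i j. \<exists>C. \<forall>t\<ge>0. \<bar>Q i t - Q j t\<bar> \<le> C"
    and \<pi>: "bij \<pi>" and s: "\<And>j. \<bar>s j\<bar> = 1"
  shows "signed_perm_matrix \<pi> s \<in> quasi_sym w"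
proof -
  define M where "M = transpose (signed_perm_matrix \<pi> s)"
  have s0: "s j \<noteq> 0" for j using s[of j] by auto
  have inv: "invertible (signed_perm_matrix \<pi> s)"
    using \<pi> by (intro invertible_signed_perm_matrix s0) (auto simp: bij_def)
  then have invM: "invertible M" unfolding M_def by (rule transpose_invertible)
  obtain C where C: "\<And>i j t. 0 \<le> t \<Longrightarrow> \<bar>Q i t - Q j t\<bar> \<le> C i j" using Q_diff by metis
  define l where "l = (\<Prod>j\<in>UNIV. exp (- C j (\<pi> j)))"
  have "l > 0" unfolding l_def by (intro prod_pos) auto
  moreover have "AE \<xi> in lebesgue. l * w \<xi> \<le> w (M *v \<xi>)"
    using w_prod AE_lebesgue_matrix_preimage[OF w_prod invM]
  proof eventually_elim
    case (elim \<xi>)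
    have "w \<xi> = (\<Prod>j\<in>UNIV. exp (- Q (\<pi> j) \<bar>\<xi> $ \<pi> j\<bar>))"
      using prod.reindex_bij_betw[OF \<pi>, of "\<lambda>i. exp (- Q i \<bar>\<xi> $ i\<bar>)"] elim(1) by simp
    then have "l * w \<xi> = (\<Prod>j\<in>UNIV. exp (- C j (\<pi> j)) * exp (- Q (\<pi> j) \<bar>\<xi> $ \<pi> j\<bar>))"
      by (simp add: l_def prod.distrib)
    also have "\<dots> \<le> (\<Prod>j\<in>UNIV. exp (- Q j \<bar>\<xi> $ \<pi> j\<bar>))"
    proof (rule prod_mono, intro conjI)
      fix j
      show "exp (- C j (\<pi> j)) * exp (- Q (\<pi> j) \<bar>\<xi> $ \<pi> j\<bar>) \<le> exp (- Q j \<bar>\<xi> $ \<pi> j\<bar>)"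
        using C[of "\<bar>\<xi> $ \<pi> j\<bar>" j "\<pi> j"] by (simp add: exp_add[symmetric] abs_le_iff)
    qed simp
    also have "\<dots> = w (M *v \<xi>)"
      unfolding elim(2) unfolding M_def transpose_signed_perm_matrix_mult by (simp add: abs_mult s)
    finally show ?case .
  qed
  ultimately show ?thesis using inv unfolding quasi_sym_def M_def by blast
qed

text \<open>Two signed permutation matrices that differ in one sign differ by twice a matrix unit, and a
  transposition puts this entry anywhere.\<close>

lemma span_quasi_sym:
  fixes w :: "real^'d \<Rightarrow> real" and Q :: "'d \<Rightarrow> real \<Rightarrow> real"
  assumes w_prod: "AE \<xi> in lebesgue. w \<xi> = (\<Prod>i\<in>UNIV. exp (- Q i \<bar>\<xi> $ i\<bar>))"
    and Q_diff: "\<And>i j. \<exists>C. \<forall>t\<ge>0. \<bar>Q i t - Q j t\<bar> \<le> C"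
  shows "span (quasi_sym w) = UNIV"
proof -
  have "axis k (axis j 1) \<in> span (quasi_sym w)" for k j :: 'd
  proof -
    define \<pi> where "\<pi> = (\<lambda>i. if i = j then k else if i = k then j else i)"
    have "\<pi> \<circ> \<pi> = id" by (auto simp: \<pi>_def)
    then have \<pi>: "bij \<pi>" by (rule o_bij) fact
    have "axis k (axis j 1) = (1/2) *\<^sub>R (signed_perm_matrix \<pi> (\<lambda>_. 1)
        - signed_perm_matrix \<pi> (\<lambda>i. if i = j then -1 else 1))"
      by (auto simp: vec_eq_iff axis_def signed_perm_matrix_def \<pi>_def)
    also have "\<dots> \<in> span (quasi_sym w)"
      by (intro span_scale span_diff span_base signed_perm_matrix_quasi_sym[OF w_prod Q_diff \<pi>]) auto
    finally show ?thesis .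
  qed
  then have "(Basis :: (real^'d^'d) set) \<subseteq> span (quasi_sym w)"
    by (auto simp: Basis_vec_def)
  then have "span (Basis :: (real^'d^'d) set) \<subseteq> span (quasi_sym w)"
    by (rule span_minimal) (rule subspace_span)
  then show ?thesis by (simp add: span_Basis top.extremum_unique)
qed


section \<open>Polynomial growth and symmetries of the weight\<close>

theorem theorem7:
  fixes w :: "real^'d \<Rightarrow> real" and Q :: "'d \<Rightarrow> real \<Rightarrow> real"
  assumes w_L1: "integrable lebesgue w"
    and w_Linf: "\<exists>C. AE \<xi> in lebesgue. \<bar>w \<xi>\<bar> \<le> C"
    and w_nonzero: "\<not> (AE \<xi> in lebesgue. w \<xi> = 0)"
    and w_decay: "\<forall>a>0. \<exists>c>0. AE \<xi> in lebesgue. w \<xi> \<le> c * exp (- a * norm \<xi>)"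
    and Q_meas: "\<And>i. Q i \<in> borel_measurable (lebesgue_on {0..})"
    and w_prod: "AE \<xi> in lebesgue. w \<xi> = (\<Prod>i\<in>UNIV. exp (- Q i \<bar>\<xi> $ i\<bar>))"
    and Q_diff: "\<And>i j. \<exists>C. \<forall>t\<ge>0. \<bar>Q i t - Q j t\<bar> \<le> C"
    and Q_osc: "\<And>i L. L > 0 \<Longrightarrow> \<exists>B>0. \<forall>\<^sub>F t in at_top.
      (\<integral>\<^sup>+\<theta>\<in>{0..pi/2}. e2ennreal (oscillation_part (shift_lin L (Q i)) (t * cos \<theta>)) \<partial>lebesgue)
        < ennreal (B + ln t)"
  shows "(\<exists>B>0. \<forall>y :: real^'d.
            limsup (\<lambda>n. E_minus n y w) < ennreal B \<and> limsup (\<lambda>n. E_plus n y w) < ennreal B)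
       \<and> span (quasi_sym w) = UNIV"
proof
  show "span (quasi_sym w) = UNIV" by (rule span_quasi_sym[OF w_prod Q_diff])
  \<comment> \<open>The integrals over single coordinates need Borel functions; changing each \<open>Q i\<close> on a null set changes
    neither the weight nor the oscillation integrals.\<close>
  have "\<forall>i. \<exists>q. q \<in> borel_measurable borel \<and> (AE t in lborel. 0 \<le> t \<longrightarrow> Q i t = q t)"
  proof
    fix i
    obtain q where "q \<in> borel_measurable borel" "AE t in lborel. 0 \<le> t \<longrightarrow> Q i t = q t"
      by (rule borel_version_on_halfline[OF Q_meas])
    then show "\<exists>q. q \<in> borel_measurable borel \<and> (AE t in lborel. 0 \<le> t \<longrightarrow> Q i t = q t)" by blast
  qed
  from choice[OF this] obtain q where q': "\<forall>i. q i \<in> borel_measurable borel \<and>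
    (AE t in lborel. 0 \<le> t \<longrightarrow> Q i t = q i t)" ..
  then have q: "\<And>i. q i \<in> borel_measurable borel"
    "\<And>i. AE t in lborel. 0 \<le> t \<longrightarrow> Q i t = q i t" by simp_all
  have "AE \<xi> in lebesgue. Q i \<bar>\<xi> $ i\<bar> = q i \<bar>\<xi> $ i\<bar>" for i
  proof -
    have "AE t in lborel. Q i \<bar>t\<bar> = q i \<bar>t\<bar>"
    proof -
      have "AE t in lborel. 0 \<le> \<bar>t\<bar> \<longrightarrow> Q i \<bar>t\<bar> = q i \<bar>t\<bar>"
        by (rule AE_lborel_abs[OF q(2)])
      then show ?thesis by simp
    qed
    from AE_lborel_coordinate[OF this] show ?thesis by (simp only: AE_completion_iff)
  qed
  then have "AE \<xi> in lebesgue. \<forall>i. Q i \<bar>\<xi> $ i\<bar> = q i \<bar>\<xi> $ i\<bar>"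
    by (simp add: AE_all_countable)
  with w_prod have w_q: "AE \<xi> in lebesgue. w \<xi> = (\<Prod>i\<in>UNIV. exp (- q i \<bar>\<xi> $ i\<bar>))"
    by eventually_elim simp
  define b where "b = sqrt ((2 * growth_const) ^ CARD('d))"
  have b0: "0 \<le> b" using growth_const_bounds by (simp add: b_def)
  have main: "\<forall>\<^sub>F n in sequentially. E_minus n y w \<le> ennreal b \<and> E_plus n y w \<le> ennreal b" for y :: "real^'d"
  proof -
    define L where "L = 4 * norm y + 2"
    have L0: "0 < L" by (simp add: L_def add_nonneg_pos)
    have "\<exists>C\<ge>0. \<forall>\<^sub>F n in sequentially. \<forall>p. degree p \<le> n \<longrightarrow>
      (\<integral>\<^sup>+x. ennreal ((cmod (poly p (of_real x)))\<^sup>2 * exp (2 * norm y * \<bar>x\<bar> - q i \<bar>x\<bar>)) \<partial>lborel) \<le>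
      ennreal (C * growth_const ^ n) *
      (\<integral>\<^sup>+x. ennreal ((cmod (poly p (of_real x)))\<^sup>2 * exp (- (2 * norm y * \<bar>x\<bar>) - q i \<bar>x\<bar>)) \<partial>lborel)" for i
    proof -
      obtain B where B: "B > 0" "\<forall>\<^sub>F t in at_top.
        (\<integral>\<^sup>+\<theta>\<in>{0..pi/2}. e2ennreal (oscillation_part (shift_lin L (Q i)) (t * cos \<theta>)) \<partial>lebesgue)
        < ennreal (B + ln t)" using Q_osc[OF L0] by blast
      show ?thesis
        by (rule weighted_poly_comparison_1d[OF q(1) norm_ge_zero L_def less_imp_le[OF B(1)]
              eventually_minorant[OF Q_meas q(2) B(2)]])
    qed
    from weighted_poly_comparison[where Q = q, OF q(1) this less_imp_le[OF growth_const_bounds(2)]]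
    obtain C where C: "0 \<le> C" "\<forall>\<^sub>F n in sequentially. \<forall>P\<in>poly_funs n.
      (\<integral>\<^sup>+\<xi>. ennreal ((cmod (P \<xi>))\<^sup>2 * (\<Prod>i\<in>UNIV. exp (2 * norm y * \<bar>\<xi> $ i\<bar> - q i \<bar>\<xi> $ i\<bar>))) \<partial>lborel)
      \<le> ennreal (C * growth_const ^ n) ^ CARD('d) *
        (\<integral>\<^sup>+\<xi>. ennreal ((cmod (P \<xi>))\<^sup>2 * (\<Prod>i\<in>UNIV. exp (- (2 * norm y * \<bar>\<xi> $ i\<bar>) - q i \<bar>\<xi> $ i\<bar>))) \<partial>lborel)"
      by blast
    \<comment> \<open>\<open>C\<close> depends on \<open>y\<close>; enlarging the base by the factor \<open>2\<close> absorbs it for large \<open>n\<close>.\<close>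
    have "\<forall>\<^sub>F n in sequentially. C \<le> 2 ^ n"
    proof -
      obtain n0 where n0: "C < 2 ^ n0" using real_arch_pow[of 2 C] by auto
      show ?thesis
      proof (rule eventually_sequentiallyI[of n0])
        fix n assume "n0 \<le> n"
        then have "(2::real) ^ n0 \<le> 2 ^ n" by (intro power_increasing) auto
        with n0 show "C \<le> 2 ^ n" by linarith
      qed
    qed
    with C(2) eventually_gt_at_top[of "0::nat"] show ?thesis
    proof eventually_elim
      case (elim n)
      have "C * growth_const ^ n \<le> 2 ^ n * growth_const ^ n"
        using elim(3) growth_const_bounds by (intro mult_right_mono) auto
      then have K: "C * growth_const ^ n \<le> (2 * growth_const) ^ n" by (simp add: power_mult_distrib)
      define D where "D = (C * growth_const ^ n) ^ CARD('d)"
      have CK0: "0 \<le> C * growth_const ^ n" using C(1) growth_const_bounds by simp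
      then have D0: "0 \<le> D" by (simp add: D_def)
      have "D \<le> ((2 * growth_const) ^ n) ^ CARD('d)"
        unfolding D_def by (intro power_mono K CK0)
      also have "\<dots> = ((2 * growth_const) ^ CARD('d)) ^ n" by (metis power_mult mult.commute)
      finally have "sqrt D \<le> b ^ n" by (simp add: b_def real_sqrt_power[symmetric])
      define N where "N = (\<lambda>f. \<integral>\<^sup>+\<xi>. ennreal ((cmod (f \<xi>))\<^sup>2) * ennreal (w \<xi>) \<partial>lebesgue)"
      have N: "N f = (\<integral>\<^sup>+\<xi>. ennreal ((cmod (f \<xi>))\<^sup>2 * (\<Prod>i\<in>UNIV. exp (- q i \<bar>\<xi> $ i\<bar>))) \<partial>lborel)" for f
      proof -
        have "N f = (\<integral>\<^sup>+\<xi>. ennreal ((cmod (f \<xi>))\<^sup>2 * (\<Prod>i\<in>UNIV. exp (- q i \<bar>\<xi> $ i\<bar>))) \<partial>lebesgue)"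
          unfolding N_def
        proof (rule nn_integral_cong_AE)
          show "AE \<xi> in lebesgue. ennreal ((cmod (f \<xi>))\<^sup>2) * ennreal (w \<xi>)
              = ennreal ((cmod (f \<xi>))\<^sup>2 * (\<Prod>i\<in>UNIV. exp (- q i \<bar>\<xi> $ i\<bar>)))"
            using w_q by eventually_elim (simp add: ennreal_mult prod_nonneg)
        qed
        then show ?thesis by (simp only: nn_integral_completion)
      qed
      have L2_norm: "L2_norm_weight w f = enn_root 2 (N f)" for f
        by (simp only: L2_norm_weight_def N_def)
      \<comment> \<open>Both \<open>P = exp_mult 0 P\<close> and \<open>exp_mult y P\<close> lie in the sandwich, so either may be on the left.\<close>
      have compare: "N (exp_mult y1 P) \<le> ennreal D * N (exp_mult y2 P)"
        if P: "P \<in> poly_funs n" and y: "norm y1 \<le> norm y" "norm y2 \<le> norm y" for P y1 y2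
      proof -
        have "N (exp_mult y1 P) \<le> (\<integral>\<^sup>+\<xi>. ennreal ((cmod (P \<xi>))\<^sup>2 *
            (\<Prod>i\<in>UNIV. exp (2 * norm y * \<bar>\<xi> $ i\<bar> - q i \<bar>\<xi> $ i\<bar>))) \<partial>lborel)"
          unfolding N by (intro nn_integral_mono ennreal_leI exp_mult_sandwich(2) y)
        also have "\<dots> \<le> ennreal (C * growth_const ^ n) ^ CARD('d) * (\<integral>\<^sup>+\<xi>. ennreal ((cmod (P \<xi>))\<^sup>2 *
            (\<Prod>i\<in>UNIV. exp (- (2 * norm y * \<bar>\<xi> $ i\<bar>) - q i \<bar>\<xi> $ i\<bar>))) \<partial>lborel)"
          using elim(1) P by blast
        also have "\<dots> \<le> ennreal (C * growth_const ^ n) ^ CARD('d) * N (exp_mult y2 P)"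
          unfolding N by (intro mult_left_mono nn_integral_mono ennreal_leI exp_mult_sandwich(1) y) simp
        also have "ennreal (C * growth_const ^ n) ^ CARD('d) = ennreal D"
          using CK0 by (simp add: D_def ennreal_power)
        finally show ?thesis .
      qed
      have ratio: "L2_norm_weight w (exp_mult y1 P) / L2_norm_weight w (exp_mult y2 P) \<le> ennreal (b ^ n)"
        if "P \<in> poly_funs n" "norm y1 \<le> norm y" "norm y2 \<le> norm y" for P y1 y2
      proof -
        have "L2_norm_weight w (exp_mult y1 P) / L2_norm_weight w (exp_mult y2 P) \<le> ennreal (sqrt D)"
          unfolding L2_norm
          by (rule enn_root_ratio_le[OF compare[OF that] D0])
        also have "\<dots> \<le> ennreal (b ^ n)" using \<open>sqrt D \<le> b ^ n\<close> by (rule ennreal_leI)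
        finally show ?thesis .
      qed
      have zero: "exp_mult 0 P = P" for P :: "real^'d \<Rightarrow> complex" by (simp add: exp_mult_def)
      have "E_minus n y w \<le> ennreal b" unfolding E_minus_def
      proof (intro enn_root_power_bound SUP_least b0 elim(2))
        fix P :: "real^'d \<Rightarrow> complex" assume "P \<in> poly_funs n - {\<lambda>_. 0}"
        then show "L2_norm_weight w P / L2_norm_weight w (exp_mult y P) \<le> ennreal (b ^ n)"
          using ratio[of P 0 y] by (simp add: zero)
      qed
      moreover have "E_plus n y w \<le> ennreal b" unfolding E_plus_def
      proof (intro enn_root_power_bound SUP_least b0 elim(2))
        fix P :: "real^'d \<Rightarrow> complex" assume "P \<in> poly_funs n - {\<lambda>_. 0}"
        then show "L2_norm_weight w (exp_mult y P) / L2_norm_weight w P \<le> ennreal (b ^ n)"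
          using ratio[of P y 0] by (simp add: zero)
      qed
      ultimately show ?case by simp
    qed
  qed
  show "\<exists>B>0. \<forall>y :: real^'d. limsup (\<lambda>n. E_minus n y w) < ennreal B \<and> limsup (\<lambda>n. E_plus n y w) < ennreal B"
  proof (intro exI[of _ "b + 1"] conjI allI)
    show "0 < b + 1" using b0 by simp
    have lt: "ennreal b < ennreal (b + 1)" using b0 by (simp add: ennreal_less_iff)
    fix y :: "real^'d"
    have "limsup (\<lambda>n. E_minus n y w) \<le> ennreal b"
      by (rule Limsup_bounded) (use main[of y] in \<open>auto elim: eventually_mono\<close>)
    then show "limsup (\<lambda>n. E_minus n y w) < ennreal (b + 1)" using lt by (rule le_less_trans)
    have "limsup (\<lambda>n. E_plus n y w) \<le> ennreal b"
      by (rule Limsup_bounded) (use main[of y] in \<open>auto elim: eventually_mono\<close>)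
    then show "limsup (\<lambda>n. E_plus n y w) < ennreal (b + 1)" using lt by (rule le_less_trans)
  qed
qed

end
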